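(* For every positive integer $n$ and all $S,T\subseteq[n]$ with $|S|=|T|$, one has $\mathrm{pmaj}(M)=\mathrm{cr}_2(\phi(M))$ for all $M\in P_n(S,T)$, where $\phi$ is the map defined in the context.
   Context: **Set partitions.** $[n]=\{1,\dots,n\}$. For a set partition $P$ of $[n]$, its arcs are the pairs $(i,j)$, $i<j$, such that $i,j$ are consecutive elements (in numerical order) of the same block; $i$ is the left-hand endpoint and $j$ the right-hand endpoint. The set of arcs determines $P$. $\min(P)$ (resp. $\max(P)$) is the set of minimal (resp. maximal) elements of the blocks of $P$, and $P_n(S,T)$ is the set of partitions $P$ of $[n]$ with $\min(P)=S$ and $\max(P)=T$. A matching is a partition all of whose blocks have two elements. Two arcs cross if, naming them suitably as $(a,b),(c,d)$, one has $a<c<b<d$. $\mathrm{cr}_2(P)$ is the number of (unordered) pairs of crossing arcs of $P$. **pmaj.** For a word $w=a_1\cdots a_t$ of integers, $\mathrm{des}(w)$ is the number of $1\le i<t$ with $a_i>a_{i+1}$. Let the arcs of $P$ be $(i_1,j_1),\dots,(i_k,j_k)$ with $i_1>\cdots>i_k$, and give $(i_r,j_r)$ the label $r$. Let $r_1>\cdots>r_k$ be the right-hand endpoints. $\sigma(r_1)$ is the one-letter word $a$, the label of the arc with right-hand endpoint $r_1$; $\sigma(r_{i+1})$ is obtained from $\sigma(r_i)$ by deleting the labels of all arcs whose left-hand endpoint $\ell$ satisfies $r_{i+1}\le\ell<r_i$ and then adding at the very beginning the label of the arc with right-hand endpoint $r_{i+1}$. Then $\mathrm{pmaj}(P)=\sum_{i=1}^k\mathrm{des}(\sigma(r_i))$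 (equal to $0$ if there are no arcs). **Reduction to matchings.** Given $P\in P_n(S,T)$, replace each $i\notin S\cup T$ by two neighbouring points $i^0<i^1$ such that the arc ending at $i$ now ends at $i^0$ and the arc starting at $i$ now starts at $i^1$; remove all isolated points. This gives a matching $M(P)$ on a linearly ordered vertex set. $\phi(P)$ is obtained from $\phi(M(P))$ by identifying each pair $i^0,i^1$ to one point $i$ and adding back all isolated vertices. So it suffices to define $\phi$ on matchings. It is extended from matchings of $[2m]$ to matchings on any vertices $a_1<\dots<a_{2m}$ by identifying $a_i$ with $i$. ($\phi$ of the empty matching is the empty matching.) **Definition of $\phi$ on matchings of $[2m]$, by induction on $m$.** For $m=1$, $\phi$ is the identity. For $m>1$, let $(i,2m)$ be the arc of $M$ incident to $2m$, let $M_1=M\setminus\{(i,2m)\}$ and $M_1'=\phi(M_1)$. An arc $(a,b)$ is *large* if $a<i$ and *small* if $a>i$. Let $\mathcal R$ be the set of right-hand endpoints of $M_1'$ lying between $i$ and $2m$. Define the critical large arc $e_L=(e_L^l,e_L^r)$ of $M_1'$ as the large arc with the biggest right-hand endpoint in $\mathcal R$, and the critical small arc $e_S=(e_S^l,e_S^r)$ as the small arc with the smallest left-hand endpoint which crosses $e_L$. If both exist, set $\mathcal R_0=\{j\in\mathcal R:e_S^r<j<2m\}$, $\mathcal R_1=\{j\in\mathcal R:e_S^l<j\le e_S^r\}$, $\mathcal R_2=\{j\in\mathcal R:i<j<e_S^l\}$. If $e_L$ does not exist, set $\mathcal R_1=\mathcal R_2=\emptyset$, $\mathcal R_0=\mathcal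 R$. If $e_L$ exists but no small arc crosses it, set $\mathcal R_2=\{j\in\mathcal R:i<j\le e_L^r\}$, $\mathcal R_1=\emptyset$, $\mathcal R_0=\mathcal R\setminus\mathcal R_2$. These sets are computed once from $M_1'$. Then $M_1'$ is transformed as follows (the arcs referred to in each step are those of the current matching). Arcs whose right-hand endpoints are in $\mathcal R_0$ are fixed. First apply Algorithm I, then Algorithm II. *Algorithm I* (if $\mathcal R_1\ne\emptyset$). (A) Let $ptr_1$ point to $e_S^r$ and $ptr_2$ to the next vertex of $\mathcal R_1$ on the left of $e_S^r$. (B) If $ptr_2$ is null, stop. Otherwise let $ptr_1=j_1$, $ptr_2=j_2$, where $j_1,j_2$ are the right-hand endpoints of the arcs $(i_1,j_1)$ and $(i_2,j_2)$. (B1) If $(i_2,j_2)$ is large, change $\{(i_1,j_1),(i_2,j_2)\}$ to $\{(i_1,j_2),(i_2,j_1)\}$ and move $ptr_1$ to $j_2$. (B2) If $(i_2,j_2)$ is small: (B2.1) if there is no right-hand endpoint between $i_1$ and $i_2$, move $ptr_1$ to $j_2$; (B2.2) if $i_1<i_2$ and there are right-hand endpoints between $i_1$ and $i_2$, do nothing; (B2.3) if $i_2<i_1$ and there are right-hand endpoints between $i_1$ and $i_2$, find the smallest $j_3>j_1$ such that $(i_3,j_3)$ is a large arc, change $\{(i_1,j_1),(i_2,j_2),(i_3,j_3)\}$ to $\{(i_1,j_2),(i_2,j_3),(i_3,j_1)\}$, and move $ptr_1$ to $j_2$. (C) Move $ptr_2$ to the next vertex of $\mathcal R_1$ on the left of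 $j_2$ and go to (B). *Algorithm II* (if $\mathcal R_2\neq\emptyset$). Let $t_0$ be the rightmost vertex of $\mathcal R_2$, the right-hand endpoint of the arc $(i_0,t_0)$. Pre-process: if $(i_0,t_0)$ is small, find the large arc $(i_1,t_1)$ with $t_1>t_0$ and $t_1$ smallest (it exists), and change $\{(i_0,t_0),(i_1,t_1)\}$ to $\{(i_0,t_1),(i_1,t_0)\}$. Then: (A$'$) Let $ptr_1$ point to $t_0$ and $ptr_2$ to the next vertex of $\mathcal R$ on the left of $t_0$. (B$'$) If $ptr_2$ is null, stop. Otherwise let $ptr_1=j_1$, $ptr_2=j_2$, right-hand endpoints of the arcs $(i_1,j_1)$, $(i_2,j_2)$. (B$'$1) If $(i_2,j_2)$ is large, do nothing. (B$'$2) If $(i_2,j_2)$ is small, change the two arcs to $(i_1,j_2)$ and $(i_2,j_1)$. (C$'$) Move $ptr_1$ to $j_2$ and $ptr_2$ to the next vertex of $\mathcal R$ on the left of $j_2$; go to (B$'$). Let $M_2$ be the resulting matching. Then $\phi(M)=M_2\cup\{(i,2m)\}$. *)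

theory Defs
  imports Main "HOL-Library.Disjoint_Sets"
begin

section \<open>Set partitions and their arcs\<close>

definition arcs :: "'a::linorder set set \<Rightarrow> ('a \<times> 'a) set" where
  "arcs P = {(i, j). i < j \<and> (\<exists>B\<in>P. i \<in> B \<and> j \<in> B \<and> \<not> (\<exists>k\<in>B. i < k \<and> k < j))}"

definition set_partitions :: "nat \<Rightarrow> nat set \<Rightarrow> nat set \<Rightarrow> nat set set set" where
  "set_partitions n S T = {P. partition_on {1..n} P \<and> Min ` P = S \<and> Max ` P = T}"

text \<open>The partition of \<open>V\<close> whose set of arcs is \<open>A\<close>: its blocks are the connected components of
  the graph with vertex set \<open>V\<close> and edges \<open>A\<close>.\<close>

definition partition_of_arcs :: "'a set \<Rightarrow> ('a \<times> 'a) set \<Rightarrow> 'a set set" where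
  "partition_of_arcs V A = V // (A \<union> A\<inverse>)\<^sup>*"

text \<open>From here on, an arc is a pair (left-hand endpoint, right-hand endpoint), so that
  \<^term>\<open>Range A\<close> is the set of right-hand endpoints of a set of arcs \<open>A\<close>. The next two
  functions are only used at endpoints of arcs, which lie on a unique arc on that side.\<close>

definition left_end :: "('a \<times> 'a) set \<Rightarrow> 'a \<Rightarrow> 'a" where
  "left_end A j = (THE i. (i, j) \<in> A)"

definition right_end :: "('a \<times> 'a) set \<Rightarrow> 'a \<Rightarrow> 'a" where
  "right_end A i = (THE j. (i, j) \<in> A)"

definition crosses :: "'a::linorder \<times> 'a \<Rightarrow> 'a \<times> 'a \<Rightarrow> bool" where
  "crosses e f \<longleftrightarrow> (fst e < fst f \<and> fst f < snd e \<and> snd e < snd f)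
                \<or> (fst f < fst e \<and> fst e < snd f \<and> snd f < snd e)"

definition cr2 :: "'a::linorder set set \<Rightarrow> nat" where
  "cr2 P = card {{e, f} | e f. e \<in> arcs P \<and> f \<in> arcs P \<and> crosses e f}"

section \<open>The statistic pmaj\<close>

definition des :: "'a::linorder list \<Rightarrow> nat" where
  "des w = card {i. Suc i < length w \<and> w ! i > w ! Suc i}"

text \<open>The arcs are labelled \<open>1, 2, \<dots>\<close> in decreasing order of their left-hand endpoints.\<close>

definition arc_label :: "('a::linorder \<times> 'a) set \<Rightarrow> 'a \<times> 'a \<Rightarrow> nat" where
  "arc_label A e = card {f \<in> A. fst e \<le> fst f}"

definition right_ends_desc :: "('a::linorder \<times> 'a) set \<Rightarrow> 'a list" where
  "right_ends_desc A = rev (sorted_list_of_set (Range A))"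

text \<open>Words are indexed from \<open>0\<close>: \<open>sigma A i\<close> is the word attached to the right-hand endpoint
  \<open>right_ends_desc A ! i\<close>.\<close>

primrec sigma :: "('a::linorder \<times> 'a) set \<Rightarrow> nat \<Rightarrow> nat list" where
  "sigma A 0 = (let r = right_ends_desc A ! 0 in [arc_label A (left_end A r, r)])"
| "sigma A (Suc i) =
     (let r = right_ends_desc A ! i; r' = right_ends_desc A ! Suc i in
      arc_label A (left_end A r', r') #
      filter (\<lambda>a. a \<notin> arc_label A ` {e \<in> A. r' \<le> fst e \<and> fst e < r}) (sigma A i))"

definition pmaj :: "'a::linorder set set \<Rightarrow> nat" where
  "pmaj P = (\<Sum>i < card (arcs P). des (sigma (arcs P) i))"

section \<open>The map phi on matchings\<close>

text \<open>A matching is given by its set of arcs, on any finite set of vertices of a linear order.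
  All the definitions below only compare vertices, so a matching on \<open>a\<^sub>1 < \<dots> < a\<^sub>2\<^sub>m\<close> is
  treated exactly as the matching on \<open>1 < \<dots> < 2m\<close> obtained by identifying \<open>a\<^sub>i\<close> with \<open>i\<close>.

  Throughout, \<open>(i, z)\<close> is the arc of the given matching incident to its largest vertex \<open>z\<close>, and
  \<open>N\<close> is the image under phi of the matching without that arc. An arc is large or small according
  to whether its left-hand endpoint is \<open>< i\<close> or \<open>> i\<close>.\<close>

definition right_ends_between :: "'a::linorder \<Rightarrow> 'a \<Rightarrow> ('a \<times> 'a) set \<Rightarrow> 'a set" where
  "right_ends_between i z N = {j \<in> Range N. i < j \<and> j < z}"

definition large_candidates :: "'a::linorder \<Rightarrow> 'a \<Rightarrow> ('a \<times> 'a) set \<Rightarrow> ('a \<times> 'a) set" where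
  "large_candidates i z N = {e \<in> N. fst e < i \<and> snd e \<in> right_ends_between i z N}"

text \<open>The critical large arc exists iff \<open>large_candidates i z N\<close> is nonempty.\<close>

definition critical_large :: "'a::linorder \<Rightarrow> 'a \<Rightarrow> ('a \<times> 'a) set \<Rightarrow> 'a \<times> 'a" where
  "critical_large i z N =
     (let r = Max (snd ` large_candidates i z N) in (left_end N r, r))"

definition small_candidates :: "'a::linorder \<Rightarrow> 'a \<Rightarrow> ('a \<times> 'a) set \<Rightarrow> ('a \<times> 'a) set" where
  "small_candidates i z N =
     (if large_candidates i z N = {} then {}
      else {e \<in> N. i < fst e \<and> crosses e (critical_large i z N)})"

text \<open>The critical small arc exists iff \<open>small_candidates i z N\<close> is nonempty.\<close>

definition critical_small :: "'a::linorder \<Rightarrow> 'a \<Rightarrow> ('a \<times> 'a) set \<Rightarrow> 'a \<times> 'a" where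
  "critical_small i z N =
     (let l = Min (fst ` small_candidates i z N) in (l, right_end N l))"

text \<open>The set \<open>\<R>\<close> of right-hand endpoints between \<open>i\<close> and \<open>z\<close> is split into \<open>\<R>\<^sub>0\<close>,
  \<open>\<R>\<^sub>1\<close> and \<open>\<R>\<^sub>2\<close>. Nothing is done on account of \<open>\<R>\<^sub>0\<close>, the complement of the following
  two sets in \<open>\<R>\<close>, so it does not appear explicitly.\<close>

definition R1 :: "'a::linorder \<Rightarrow> 'a \<Rightarrow> ('a \<times> 'a) set \<Rightarrow> 'a set" where
  "R1 i z N =
     (if small_candidates i z N = {} then {}
      else {j \<in> right_ends_between i z N.
              fst (critical_small i z N) < j \<and> j \<le> snd (critical_small i z N)})"

definition R2 :: "'a::linorder \<Rightarrow> 'a \<Rightarrow> ('a \<times> 'a) set \<Rightarrow> 'a set" where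
  "R2 i z N =
     (if large_candidates i z N = {} then {}
      else if small_candidates i z N = {}
      then {j \<in> right_ends_between i z N. j \<le> snd (critical_large i z N)}
      else {j \<in> right_ends_between i z N. j < fst (critical_small i z N)})"

text \<open>The right-hand endpoint of a large arc that is closest to \<open>j\<close> on the right.\<close>

definition next_large :: "'a::linorder \<Rightarrow> ('a \<times> 'a) set \<Rightarrow> 'a \<Rightarrow> 'a" where
  "next_large i M j = Min {t. j < t \<and> (\<exists>s. (s, t) \<in> M \<and> s < i)}"

text \<open>One round of Algorithm I. The state consists of the current matching and the vertex
  \<open>j\<^sub>1\<close> at the first pointer; the second pointer is at \<open>j\<^sub>2\<close>.\<close>

definition alg1_step :: "'a::linorder \<Rightarrow> ('a \<times> 'a) set \<times> 'a \<Rightarrow> 'a \<Rightarrow> ('a \<times> 'a) set \<times> 'a" where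
  "alg1_step i st j2 =
     (let M = fst st; j1 = snd st; i1 = left_end M j1; i2 = left_end M j2 in
      if i2 < i then (M - {(i1, j1), (i2, j2)} \<union> {(i1, j2), (i2, j1)}, j2)
      else if \<not> (\<exists>r \<in> Range M. min i1 i2 < r \<and> r < max i1 i2) then (M, j2)
      else if i1 < i2 then (M, j1)
      else let j3 = next_large i M j1; i3 = left_end M j3 in
           (M - {(i1, j1), (i2, j2), (i3, j3)} \<union> {(i1, j2), (i2, j3), (i3, j1)}, j2))"

definition alg1 :: "'a::linorder \<Rightarrow> 'a \<Rightarrow> ('a \<times> 'a) set \<Rightarrow> ('a \<times> 'a) set" where
  "alg1 i z N =
     (if R1 i z N = {} then N
      else let t = snd (critical_small i z N) in
           fst (foldl (alg1_step i) (N, t) (rev (sorted_list_of_set {j \<in> R1 i z N. j < t}))))"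

definition alg2_preprocess :: "'a::linorder \<Rightarrow> ('a \<times> 'a) set \<Rightarrow> 'a \<Rightarrow> ('a \<times> 'a) set" where
  "alg2_preprocess i M t0 =
     (let i0 = left_end M t0 in
      if i < i0
      then let t1 = next_large i M t0; i1 = left_end M t1 in
           M - {(i0, t0), (i1, t1)} \<union> {(i0, t1), (i1, t0)}
      else M)"

definition alg2_step :: "'a::linorder \<Rightarrow> ('a \<times> 'a) set \<times> 'a \<Rightarrow> 'a \<Rightarrow> ('a \<times> 'a) set \<times> 'a" where
  "alg2_step i st j2 =
     (let M = fst st; j1 = snd st; i1 = left_end M j1; i2 = left_end M j2 in
      if i2 < i then (M, j2)
      else (M - {(i1, j1), (i2, j2)} \<union> {(i1, j2), (i2, j1)}, j2))"

text \<open>\<open>M\<close> is the result of Algorithm I; the sets \<open>\<R>\<close> and \<open>\<R>\<^sub>2\<close> are still those of \<open>N\<close>.\<close>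

definition alg2 :: "'a::linorder \<Rightarrow> 'a \<Rightarrow> ('a \<times> 'a) set \<Rightarrow> ('a \<times> 'a) set \<Rightarrow> ('a \<times> 'a) set" where
  "alg2 i z N M =
     (if R2 i z N = {} then M
      else let t0 = Max (R2 i z N) in
           fst (foldl (alg2_step i) (alg2_preprocess i M t0, t0)
                  (rev (sorted_list_of_set {j \<in> right_ends_between i z N. j < t0}))))"

text \<open>The first argument of \<open>phi_rec\<close> is the number of arcs.\<close>

primrec phi_rec :: "nat \<Rightarrow> ('a::linorder \<times> 'a) set \<Rightarrow> ('a \<times> 'a) set" where
  "phi_rec 0 M = M"
| "phi_rec (Suc m) M =
     (if m = 0 then M
      else let z = Max (Field M); i = left_end M z; N = phi_rec m (M - {(i, z)}) in
           alg2 i z N (alg1 i z N) \<union> {(i, z)})"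

definition phi_matching :: "('a::linorder \<times> 'a) set \<Rightarrow> ('a \<times> 'a) set" where
  "phi_matching M = phi_rec (card M) M"

section \<open>The map phi on set partitions\<close>

text \<open>The two copies \<open>v\<^sup>0 < v\<^sup>1\<close> of a vertex \<open>v\<close> are encoded as \<open>2v\<close> (for the arc ending at \<open>v\<close>)
  and \<open>2v + 1\<close> (for the arc starting at \<open>v\<close>). A vertex on only one arc is represented by only
  one of these two numbers, which is harmless as only the relative order of vertices matters;
  isolated vertices disappear. Identifying the copies again is division by \<open>2\<close>.\<close>

definition split_matching :: "nat set set \<Rightarrow> (nat \<times> nat) set" where
  "split_matching P = (\<lambda>(i, j). (2 * i + 1, 2 * j)) ` arcs P"

definition phi :: "nat set set \<Rightarrow> nat set set" where
  "phi P = partition_of_arcs (\<Union>P)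
             (map_prod (\<lambda>v. v div 2) (\<lambda>v. v div 2) ` phi_matching (split_matching P))"

end

theory Submission
  imports Defs
begin

text \<open>Both statistics are computed by removing the arc \<open>(i, z)\<close> at the largest vertex.

The word attached to a right-hand endpoint \<open>r\<close> lists the arcs \<open>(a, b)\<close> with \<open>a < r \<le> b\<close> by
increasing \<open>b\<close>, and a descent is a pair of neighbours in this list whose left-hand endpoints
increase. Adding \<open>(i, z)\<close> appends one letter to the words of all \<open>r > i\<close>, so pmaj grows by the number
of \<open>r > i\<close> for which the arc reaching farthest to the right, among those that start before \<open>r\<close>,
starts before \<open>i\<close> (lemma \<open>ascent_sum_insert_max\<close>). In the notation of the definition of phi,
these \<open>r\<close> are the elements of \<open>\<R>\<^sub>2\<close>.

On the other side, \<open>(i, z)\<close> crosses every large arc with right-hand endpoint in \<open>\<R>\<close>. Algorithm I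
removes one crossing for every large arc in \<open>\<R>\<^sub>1\<close> (lemma \<open>alg1_loop\<close>) and Algorithm II creates
one for every small arc in \<open>\<R>\<^sub>2\<close> (lemma \<open>alg2_outcome\<close>). As \<open>\<R>\<^sub>0\<close> contains no large arcs, the number of
crossings grows by the size of \<open>\<R>\<^sub>2\<close> as well (lemma \<open>algorithms_outcome\<close>). These counts all come
from one formula for the effect of exchanging the right-hand endpoints of two arcs, lemma
\<open>crossings_swap\<close>.

The first \<open>\<R>\<^sub>2\<close> refers to the matching without \<open>(i, z)\<close> and the second one to its image under phi. They
agree because phi preserves, for every position \<open>p\<close>, the left-hand endpoint of the arc reaching
farthest among those that start before \<open>p\<close>. The algorithms move large arcs past small ones only,
so large arcs never overtake one another; and beyond \<open>i\<close> the arc \<open>(i, z)\<close> itself reaches farthest.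
Lemma \<open>phi_rec_arc_set\<close> combines the two inductions.\<close>

section \<open>Matchings as functions on right-hand endpoints\<close>

text \<open>A matching is handled as a set \<open>R\<close> of right-hand endpoints with a function \<open>L\<close> giving the left-hand
endpoint of the arc ending at each of them. The algorithms exchange right-hand endpoints and never
change \<open>R\<close>, so each of their moves becomes a pointwise update of \<open>L\<close>.\<close>

definition arc_set :: "'a set \<Rightarrow> ('a \<Rightarrow> 'a) \<Rightarrow> ('a \<times> 'a) set" where
  "arc_set R L = (\<lambda>r. (L r, r)) ` R"

definition arc_system :: "'a::linorder set \<Rightarrow> ('a \<Rightarrow> 'a) \<Rightarrow> bool" where
  "arc_system R L \<longleftrightarrow> finite R \<and> inj_on L R \<and> (\<forall>r\<in>R. L r < r)"

text \<open>The arcs of a set partition form an \<^term>\<open>arc_system\<close>, in which an arc may begin where another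
one ends. After vertices have been split this cannot happen any more.\<close>

definition matching :: "'a::linorder set \<Rightarrow> ('a \<Rightarrow> 'a) \<Rightarrow> bool" where
  "matching R L \<longleftrightarrow> arc_system R L \<and> L ` R \<inter> R = {}"

lemma matchingD:
  assumes "matching R L"
  shows "finite R" "inj_on L R" "r \<in> R \<Longrightarrow> L r < r" "r \<in> R \<Longrightarrow> s \<in> R \<Longrightarrow> L r \<noteq> s"
    "r \<in> R \<Longrightarrow> s \<in> R \<Longrightarrow> L r = L s \<longleftrightarrow> r = s"
  using assms by (auto simp: matching_def arc_system_def inj_on_def)

lemma Range_arc_set [simp]: "Range (arc_set R L) = R"
  by (auto simp: arc_set_def)

lemma mem_arc_set [simp]: "(a, r) \<in> arc_set R L \<longleftrightarrow> r \<in> R \<and> a = L r"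
  by (auto simp: arc_set_def)

lemma left_end_arc_set [simp]: "r \<in> R \<Longrightarrow> left_end (arc_set R L) r = L r"
  by (auto simp: left_end_def)

lemma card_arc_set [simp]: "card (arc_set R L) = card R"
  unfolding arc_set_def by (rule card_image) (auto simp: inj_on_def)

definition swap :: "('a \<Rightarrow> 'a) \<Rightarrow> 'a \<Rightarrow> 'a \<Rightarrow> ('a \<Rightarrow> 'a)" where
  "swap L x y = L(x := L y, y := L x)"

lemma swap_simps [simp]:
  "swap L x y y = L x" "swap L x y x = L y"
  "s \<noteq> x \<Longrightarrow> s \<noteq> y \<Longrightarrow> swap L x y s = L s"
  by (auto simp: swap_def)

lemma swap_swap [simp]: "swap (swap L x y) x y = L"
  by (auto simp: swap_def)

lemma swap_commute: "swap L x y = swap L y x"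
  by (auto simp: swap_def)

lemma swap_image [simp]: "x \<in> R \<Longrightarrow> y \<in> R \<Longrightarrow> swap L x y ` R = L ` R"
  unfolding swap_def image_def
  by (auto simp: fun_upd_def split: if_splits) (metis)+

lemma matching_swap:
  assumes "matching R L" "x \<in> R" "y \<in> R" "x < y" "L y < x"
  shows "matching R (swap L x y)"
proof -
  have "inj_on (swap L x y) R"
    using assms matchingD[OF assms(1)]
    by (auto simp: inj_on_def swap_def)
  moreover have "\<forall>r\<in>R. swap L x y r < r"
    using assms matchingD(3)[OF assms(1)] by (auto simp: swap_def intro: order.strict_trans)
  ultimately show ?thesis using assms by (auto simp: matching_def arc_system_def)
qed

lemma arc_set_swap:
  assumes "x \<in> R" "y \<in> R" "x \<noteq> y"
  shows "arc_set R L - {(L x, x), (L y, y)} \<union> {(L x, y), (L y, x)} = arc_set R (swap L x y)"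
  using assms by (auto simp: set_eq_iff swap_def)

section \<open>Counting crossings\<close>

definition crossing :: "('a::linorder \<Rightarrow> 'a) \<Rightarrow> 'a \<Rightarrow> 'a \<Rightarrow> bool" where
  "crossing L r s \<longleftrightarrow> L r < L s \<and> L s < r \<and> r < s"

definition crossings :: "'a::linorder set \<Rightarrow> ('a \<Rightarrow> 'a) \<Rightarrow> nat" where
  "crossings R L = (\<Sum>r\<in>R. \<Sum>s\<in>R. of_bool (crossing L r s))"

lemma crossings_insert:
  assumes "finite R" "x \<notin> R"
  shows "crossings (insert x R) L =
    crossings R L + (\<Sum>b\<in>R. of_bool (crossing L b x) + of_bool (crossing L x b))"
  using assms by (simp add: crossings_def sum.distrib del: sum_of_bool_eq) (simp add: crossing_def)

lemma crossings_cong: "(\<And>r. r \<in> R \<Longrightarrow> L r = L' r) \<Longrightarrow> crossings R L = crossings R L'"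
  unfolding crossings_def crossing_def by (intro sum.cong refl) simp

text \<open>The only crossing count that is needed: the exchange turns the nested pair of arcs ending at
\<open>x < y\<close> into a crossing pair, which accounts for \<open>1\<close>. The total contributed by a third arc changes only if it
ends strictly between \<open>x\<close> and \<open>y\<close> and begins strictly between the two left-hand endpoints; such an
arc crosses neither of the two arcs before the exchange and both of them afterwards. All moves of
the algorithms are exchanges of this kind, or their inverses.\<close>

lemma crossings_swap:
  assumes M: "matching R L" and xy: "x \<in> R" "y \<in> R" "x < y" "L y < L x"
  shows "crossings R (swap L x y) =
    crossings R L + 1 + 2 * card {b \<in> R. x < b \<and> b < y \<and> L y < L b \<and> L b < L x}"
proof -
  define B where "B = R - {x, y}"
  note D = matchingD[OF M]
  have R: "R = insert x (insert y B)" and B: "finite B" "x \<notin> insert y B" "y \<notin> B"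
    using D(1) xy by (auto simp: B_def)
  have lt: "L x < x" "L y < y" using D(3) xy by auto
  let ?S = "swap L x y"
  let ?c = "\<lambda>b. x < b \<and> b < y \<and> L y < L b \<and> L b < L x"
  let ?f = "\<lambda>L b. (of_bool (crossing L b y) + of_bool (crossing L y b)
                 + (of_bool (crossing L b x) + of_bool (crossing L x b)) :: nat)"
  have split: "crossings R F = crossings B F + (\<Sum>b\<in>B. ?f F b)
      + of_bool (crossing F y x) + of_bool (crossing F x y)" for F
    unfolding R using B by (simp add: crossings_insert sum.distrib)
  have third: "?f ?S b = ?f L b + 2 * of_bool (?c b)" if "b \<in> B" for b
  proof -
    have "b \<in> R" "b \<noteq> x" "b \<noteq> y" using that by (auto simp: B_def)
    then have "L b < b" "L b \<noteq> x" "L b \<noteq> y" "L b \<noteq> L x" "L b \<noteq> L y"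
      using D xy by auto
    then show ?thesis using xy lt \<open>b \<noteq> x\<close> \<open>b \<noteq> y\<close>
      by (cases b x rule: linorder_cases; cases b y rule: linorder_cases;
          cases "L b" "L x" rule: linorder_cases; cases "L b" "L y" rule: linorder_cases;
          cases "L b" x rule: linorder_cases) (auto simp: crossing_def)
  qed
  have "(\<Sum>b\<in>B. ?f ?S b) = (\<Sum>b\<in>B. ?f L b + 2 * of_bool (?c b))"
    using third by (rule sum.cong[OF refl])
  also have "\<dots> = (\<Sum>b\<in>B. ?f L b) + 2 * (\<Sum>b\<in>B. of_bool (?c b))"
    by (simp only: sum.distrib sum_distrib_left)
  also have "(\<Sum>b\<in>B. of_bool (?c b)) = card (B \<inter> {b. ?c b})"
    using B(1) by simp
  also have "B \<inter> {b. ?c b} = {b \<in> R. ?c b}" unfolding B_def by auto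
  finally have sum: "(\<Sum>b\<in>B. ?f ?S b) = (\<Sum>b\<in>B. ?f L b) + 2 * card {b \<in> R. ?c b}" .
  have "crossings B ?S = crossings B L"
    by (rule crossings_cong) (auto simp: B_def)
  moreover have "crossing ?S x y" "\<not> crossing ?S y x" "\<not> crossing L x y" "\<not> crossing L y x"
    using xy lt by (auto simp: crossing_def)
  ultimately show ?thesis unfolding split[of ?S] split[of L] sum by simp
qed

section \<open>The arc reaching farthest to the right\<close>

text \<open>\<open>farthest R L p a\<close>: among the arcs starting before \<open>p\<close>, the one with the biggest right-hand
endpoint starts at \<open>a\<close>. Equivalently, \<open>a\<close> is the last left-to-right maximum before \<open>p\<close> when the
right-hand endpoints are listed by increasing left-hand endpoint. Only the starting point of the
extremal arc is recorded: it is invariant under phi, whereas its right-hand endpoint is not.\<close>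

definition farthest :: "'a::linorder set \<Rightarrow> ('a \<Rightarrow> 'a) \<Rightarrow> 'a \<Rightarrow> 'a \<Rightarrow> bool" where
  "farthest R L p a \<longleftrightarrow> (\<exists>s\<in>R. L s = a \<and> a < p \<and> (\<forall>t\<in>R. L t < p \<longrightarrow> t \<le> s))"

text \<open>What a single exchange keeps intact when \<open>(i, z)\<close> is the last arc. Positions beyond \<open>i\<close> do not
matter, since once \<open>(i, z)\<close> is added this arc is the farthest one there.\<close>

definition rearranges :: "'a::linorder \<Rightarrow> 'a set \<Rightarrow> ('a \<Rightarrow> 'a) \<Rightarrow> ('a \<Rightarrow> 'a) \<Rightarrow> bool" where
  "rearranges i R L L' \<longleftrightarrow> matching R L' \<and> L' ` R = L ` R \<and>
     (\<forall>p a. p \<le> i \<longrightarrow> farthest R L' p a = farthest R L p a)"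

lemma rearranges_refl: "matching R L \<Longrightarrow> rearranges i R L L"
  by (simp add: rearranges_def)

lemma rearranges_trans: "rearranges i R L L' \<Longrightarrow> rearranges i R L' L'' \<Longrightarrow> rearranges i R L L''"
  by (simp add: rearranges_def)

text \<open>Small arcs start after \<open>i\<close>, so they do not compete at positions up to \<open>i\<close>.\<close>

lemma rearranges_swap_small:
  assumes "matching R L" "x \<in> R" "y \<in> R" "x < y" "L y < x" "i < L x" "i < L y"
  shows "rearranges i R L (swap L x y)"
proof -
  have "farthest R (swap L x y) p a = farthest R L p a" if "p \<le> i" for p a
  proof -
    have "(swap L x y s < p) = (L s < p)" "L s < p \<Longrightarrow> swap L x y s = L s" for s
      using assms that by (auto simp: swap_def)
    then show ?thesis unfolding farthest_def by metis
  qed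
  then show ?thesis using assms matching_swap by (auto simp: rearranges_def)
qed

text \<open>When a large arc moves past small arcs only, the right-hand endpoints of the large arcs keep their
relative order, and it is only this order that decides which of them reaches farthest.\<close>

lemma farthest_swap:
  assumes "matching R L" "x \<in> R" "y \<in> R" "L x < i" "i < L y" "p \<le> i"
    and between: "\<And>s. s \<in> R \<Longrightarrow> x < s \<and> s < y \<or> y < s \<and> s < x \<Longrightarrow> i < L s"
    and farthest: "farthest R L p a"
  shows "farthest R (swap L x y) p a"
proof -
  obtain s where s: "s \<in> R" "L s = a" "a < p" "\<And>t. t \<in> R \<Longrightarrow> L t < p \<Longrightarrow> t \<le> s"
    using farthest by (auto simp: farthest_def)
  have sy: "s \<noteq> y" using s assms by auto
  have below: "t < x \<longleftrightarrow> t < y" if "t \<in> R" "L t < p" "t \<noteq> x" for t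
  proof -
    have "L t < i" using that assms by auto
    moreover have "t \<noteq> y" using that assms by auto
    ultimately show ?thesis using between[OF that(1)] that(3)
      by (cases t y rule: linorder_cases; cases t x rule: linorder_cases;
          cases x y rule: linorder_cases) auto
  qed
  show ?thesis
  proof (cases "s = x")
    case True
    have "t \<le> y" if "t \<in> R" "swap L x y t < p" for t
    proof (cases "t = x \<or> t = y")
      case True then show ?thesis using that assms by auto
    next
      case False
      then have "L t < p" using that by simp
      then show ?thesis using below[of t] s(4)[of t] True False that by auto
    qed
    then show ?thesis unfolding farthest_def using s True assms by (intro bexI[of _ y]) auto
  next
    case False
    have "t \<le> s" if "t \<in> R" "swap L x y t < p" for t
    proof (cases "t = x \<or> t = y")
      case True
      then have "t = y" "L x < p" using that assms by auto
      then show ?thesis using below[of s] s False assms by fastforce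
    next
      case False then show ?thesis using that s by auto
    qed
    then show ?thesis unfolding farthest_def using s False sy by (intro bexI[of _ s]) auto
  qed
qed

lemma rearranges_swap:
  assumes M: "matching R L" and xy: "x \<in> R" "y \<in> R" "L x < i" "i < L y" "L x < y" "L y < x"
    and between: "\<And>s. s \<in> R \<Longrightarrow> x < s \<and> s < y \<or> y < s \<and> s < x \<Longrightarrow> i < L s"
  shows "rearranges i R L (swap L x y)"
proof -
  have M': "matching R (swap L x y)"
    using matching_swap[of R L x y] matching_swap[of R L y x] assms
    by (cases x y rule: linorder_cases) (auto simp: swap_commute)
  have "farthest R (swap L x y) p a = farthest R L p a" if p: "p \<le> i" for p a
  proof
    assume "farthest R L p a"
    from farthest_swap[OF M xy(1-4) p between this] show "farthest R (swap L x y) p a" .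
  next
    assume *: "farthest R (swap L x y) p a"
    have b: "i < swap L x y s" if "s \<in> R" "y < s \<and> s < x \<or> x < s \<and> s < y" for s
      using between[of s] that xy by auto
    have "farthest R (swap (swap L x y) y x) p a"
      by (rule farthest_swap[OF M' xy(2,1) _ _ p b *]) (use xy in auto)
    then show "farthest R L p a" by (simp add: swap_commute[of _ y x])
  qed
  then show ?thesis using M' xy by (auto simp: rearranges_def)
qed

section \<open>Algorithm I\<close>

lemma descending_interval_Cons:
  fixes R :: "'a::linorder set"
  assumes "sorted_wrt (>) (x # xs)" "set (x # xs) = {j \<in> R. c < j \<and> j < q}"
  shows "x \<in> R" "c < x" "x < q" "set xs = {j \<in> R. c < j \<and> j < x}"
    and "\<And>s. s \<in> R \<Longrightarrow> x < s \<Longrightarrow> q \<le> s"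
proof -
  have "x \<in> {j \<in> R. c < j \<and> j < q}" using assms(2) by auto
  then show x: "x \<in> R" "c < x" "x < q" by auto
  have lt: "\<And>j. j \<in> set xs \<Longrightarrow> j < x" using assms(1) by auto
  show "set xs = {j \<in> R. c < j \<and> j < x}"
  proof (intro set_eqI iffI)
    fix j assume "j \<in> set xs"
    then show "j \<in> {j \<in> R. c < j \<and> j < x}" using assms(2) lt[of j] by auto
  next
    fix j assume "j \<in> {j \<in> R. c < j \<and> j < x}"
    then have "j \<in> set (x # xs)" "j \<noteq> x" unfolding assms(2) using x by auto
    then show "j \<in> set xs" by simp
  qed
  show "q \<le> s" if "s \<in> R" "x < s" for s
  proof (rule ccontr)
    assume "\<not> q \<le> s"
    then have "s \<in> set (x # xs)" unfolding assms(2) using x that by auto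
    then show False using lt[of s] that by auto
  qed
qed

lemma next_largeE:
  assumes "finite R" "u \<in> R" "j < u" "L u < i"
  obtains t where "next_large i (arc_set R L) j = t" "t \<in> R" "j < t" "L t < i"
    "\<And>v. v \<in> R \<Longrightarrow> j < v \<Longrightarrow> v < t \<Longrightarrow> \<not> L v < i"
proof -
  let ?T = "{t. j < t \<and> (\<exists>s. (s, t) \<in> arc_set R L \<and> s < i)}"
  have T: "?T = {t \<in> R. j < t \<and> L t < i}" by auto
  have fin: "finite ?T" and ne: "?T \<noteq> {}" using assms unfolding T by auto
  have "Min ?T \<in> ?T" by (rule Min_in[OF fin ne])
  moreover have "\<not> L v < i" if "v \<in> R" "j < v" "v < Min ?T" for v
    using Min_le[OF fin, of v] that by auto
  ultimately show ?thesis by (intro that[of "Min ?T"]) (auto simp: next_large_def)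
qed

text \<open>In Algorithm I, \<open>c\<close> is the left-hand endpoint of the critical small arc. Two left-hand endpoints
with no right-hand endpoint between them are interchangeable, and \<open>reaches R c a\<close> is the statement
\<open>c \<le> a\<close> up to this equivalence.\<close>

definition reaches :: "'a::linorder set \<Rightarrow> 'a \<Rightarrow> 'a \<Rightarrow> bool" where
  "reaches R c a \<longleftrightarrow> (\<forall>r\<in>R. r < c \<longrightarrow> r < a)"

text \<open>Every large arc met by the second pointer costs exactly one crossing, and nothing else changes the
number of crossings. The loop maintains the following, where \<open>j1\<close> is the first pointer and \<open>js\<close>
are the vertices still to be visited, all of them before \<open>q\<close>. The arc at \<open>j1\<close> is small and
starts at a point equivalent to \<open>c\<close>. The arcs ending between the two pointers are the skipped ones;
they start to the right of the arc at \<open>j1\<close>. The arcs ending between \<open>j1\<close> and the next large arc on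
its right start at or after \<open>c\<close>, up to equivalence. As long as no large arc ends on the
right of \<open>j1\<close>, the small arcs still to be visited that end after all large arcs also start at or
after \<open>c\<close>, up to equivalence, because \<open>c\<close> was chosen as small as possible.

The second of these facts shows that exchanging a small and a large arc costs one crossing and not
more; the third one makes the cyclic move of three arcs neutral; the fourth one shows that the
large arc this move asks for exists. In the conclusion, the part on \<^term>\<open>reaches\<close> is
what the preprocessing in Algorithm II relies on.\<close>

lemma alg1_loop:
  fixes R :: "'a::linorder set" and L :: "'a \<Rightarrow> 'a"
  assumes "sorted_wrt (>) js" "set js = {j \<in> R. c < j \<and> j < q}"
    and "matching R L" "i \<notin> L ` R" "i < c" "c < j1"
    and "j1 \<in> R" "q \<le> j1" "i < L j1"
    and "\<forall>r\<in>R. r < c \<longleftrightarrow> r < L j1"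
    and "\<forall>s\<in>R. q \<le> s \<and> s < j1 \<longrightarrow> L j1 < L s"
    and "\<forall>u\<in>R. \<forall>s\<in>R. j1 < s \<and> s < u \<and> L u < i \<and> (\<forall>v\<in>R. j1 < v \<and> v < u \<longrightarrow> i < L v)
            \<longrightarrow> reaches R c (L s)"
    and "(\<forall>u\<in>R. L u < i \<longrightarrow> u < j1) \<Longrightarrow>
          \<forall>s\<in>R. c < s \<and> s < q \<and> i < L s \<and> (\<forall>u\<in>R. L u < i \<longrightarrow> u < s) \<longrightarrow> reaches R c (L s)"
    and "\<exists>u\<in>R. c < u \<and> L u < i"
  shows "\<exists>L' j. foldl (alg1_step i) (arc_set R L, j1) js = (arc_set R L', j) \<and>
     rearranges i R L L' \<and> (\<forall>s\<in>R. s < c \<longrightarrow> L' s = L s) \<and> (\<exists>u\<in>R. c < u \<and> L' u < i) \<and>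
     crossings R L = crossings R L' + card {s \<in> set js. L s < i} \<and>
     (\<forall>u\<in>R. \<forall>s\<in>R. c < s \<and> s < u \<and> L' u < i \<and> (\<forall>v\<in>R. c < v \<and> v < u \<longrightarrow> i < L' v)
            \<longrightarrow> reaches R c (L' s))" (is "?outcome js L j1")
  using assms
proof (induction js arbitrary: L j1 q)
  case Nil
  note M = Nil(3) and eq = Nil(10) and mid = Nil(11) and hi = Nil(12)
  have ge: "q \<le> s" if "s \<in> R" "c < s" for s
    using Nil(2) that by (auto simp: not_less[symmetric])
  have "reaches R c (L s)"
    if s: "s \<in> R" "c < s" "s < u" and u: "u \<in> R" "L u < i"
      and b: "\<forall>v\<in>R. c < v \<and> v < u \<longrightarrow> i < L v" for s u
  proof (cases s j1 rule: linorder_cases)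
    case less
    then have "L j1 < L s" using mid ge[of s] s by auto
    then show ?thesis using eq by (fastforce simp: reaches_def)
  next
    case equal
    then show ?thesis using eq by (auto simp: reaches_def)
  next
    case greater
    have "\<forall>v\<in>R. j1 < v \<and> v < u \<longrightarrow> i < L v" using b Nil(6) by fastforce
    then show ?thesis using hi greater s u by blast
  qed
  then show ?case using Nil(14) rearranges_refl[OF M] by auto
next
  case (Cons j2 js)
  note IH = Cons.IH and srt = Cons.prems(1) and setjs = Cons.prems(2) and M = Cons.prems(3)
    and iL = Cons.prems(4) and ic = Cons.prems(5) and cj1 = Cons.prems(6) and j1R = Cons.prems(7)
    and qj1 = Cons.prems(8) and ij1 = Cons.prems(9) and eq = Cons.prems(10)
    and mid = Cons.prems(11) and hi = Cons.prems(12) and none = Cons.prems(13) and ex = Cons.prems(14)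
  note D = matchingD[OF M]
  note interval = descending_interval_Cons[OF srt setjs]
  note j2 = interval(1-3) and setjs' = interval(4) and gap = interval(5)
  have srt': "sorted_wrt (>) js" and lt: "\<And>j. j \<in> set js \<Longrightarrow> j < j2" using srt by auto
  have j21: "j2 < j1" using j2 qj1 by auto
  have L1j2: "L j1 < j2" using eq j2 D(4)[OF j1R j2(1)] by (metis linorder_neqE less_asym)
  have small: "i < L s \<longleftrightarrow> \<not> L s < i" if "s \<in> R" for s using iL that by fastforce
  have mid': "L j1 < L s" if "s \<in> R" "j2 < s" "s < j1" for s using mid gap that by auto
  show ?case
  proof (cases "L j2 < i")
    case True
    \<comment> \<open>The small arc at \<open>j1\<close> and the large arc at \<open>j2\<close> cross and become nested. Read backwards, this
         is an exchange of nested arcs with no third arc involved, as the skipped arcs start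
         after \<open>L j1\<close>.\<close>
    let ?L = "swap L j2 j1"
    have step: "alg1_step i (arc_set R L, j1) j2 = (arc_set R ?L, j2)"
      using True j1R j2 j21 arc_set_swap[of j1 R j2 L]
      by (simp add: alg1_step_def Let_def swap_commute)
    have M': "matching R ?L" using matching_swap[OF M j2(1) j1R j21 L1j2] .
    have R1: "rearranges i R L ?L"
      by (rule rearranges_swap[OF M j2(1) j1R True ij1])
        (use L1j2 D(3)[OF j2(1)] j21 mid' ij1 in \<open>auto intro: order.strict_trans\<close>)
    have cr: "crossings R L = crossings R ?L + 1"
    proof -
      have "crossings R (swap ?L j2 j1) = crossings R ?L + 1 +
          2 * card {b \<in> R. j2 < b \<and> b < j1 \<and> ?L j1 < ?L b \<and> ?L b < ?L j2}"
        by (rule crossings_swap[OF M' j2(1) j1R j21]) (use True ij1 j21 in simp)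
      moreover have none: "{b \<in> R. j2 < b \<and> b < j1 \<and> ?L j1 < ?L b \<and> ?L b < ?L j2} = {}"
        using mid' j21 by fastforce
      ultimately show ?thesis unfolding none by simp
    qed
    have hi': "\<forall>u\<in>R. \<forall>s\<in>R. j2 < s \<and> s < u \<and> ?L u < i \<and> (\<forall>v\<in>R. j2 < v \<and> v < u \<longrightarrow> i < ?L v)
            \<longrightarrow> reaches R c (?L s)"
    proof (intro ballI impI, elim conjE)
      fix u s assume *: "u \<in> R" "s \<in> R" "j2 < s" "s < u" "\<forall>v\<in>R. j2 < v \<and> v < u \<longrightarrow> i < ?L v"
      have "u \<le> j1" using * j1R j21 True by (force simp: not_less[symmetric])
      then have "L j1 < L s" "?L s = L s" using mid'[of s] * by auto
      then show "reaches R c (?L s)" using eq by (fastforce simp: reaches_def)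
    qed
    have "?outcome js ?L j2"
    proof (rule IH[OF srt' setjs' M' _ ic j2(2) j2(1) order.refl _ _ _ hi'])
      show "i \<notin> ?L ` R" using iL j2 j1R by simp
      show "i < ?L j2" "\<forall>r\<in>R. (r < c) = (r < ?L j2)" using ij1 eq j21 by auto
      show "\<forall>s\<in>R. j2 \<le> s \<and> s < j2 \<longrightarrow> ?L j2 < ?L s" by auto
      show "\<exists>u\<in>R. c < u \<and> ?L u < i" using True j1R cj1 j21 by (intro bexI[of _ j1]) auto
      show "\<forall>s\<in>R. c < s \<and> s < j2 \<and> i < ?L s \<and> (\<forall>u\<in>R. ?L u < i \<longrightarrow> u < s) \<longrightarrow> reaches R c (?L s)"
        if "\<forall>u\<in>R. ?L u < i \<longrightarrow> u < j2" using that True j1R j21 by fastforce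
    qed
    moreover have "{s \<in> set (j2 # js). L s < i} = insert j2 {s \<in> set js. ?L s < i}"
    proof -
      have "?L s = L s" if "s \<in> set js" for s using lt[OF that] j21 by auto
      then show ?thesis using True by auto
    qed
    moreover have "j2 \<notin> {s \<in> set js. ?L s < i}" using lt by auto
    moreover have "?L s = L s" if "s < c" for s using that j2 cj1 by auto
    ultimately show ?thesis using step cr rearranges_trans[OF R1] by auto
  next
    case large: False
    then have sm: "i < L j2" using small j2 by auto
    have cards: "{s \<in> set (j2 # js). L s < i} = {s \<in> set js. L s < i}" using large by auto
    let ?b = "\<exists>r\<in>R. min (L j1) (L j2) < r \<and> r < max (L j1) (L j2)"
    have ne: "L j1 \<noteq> L j2" using D(5)[OF j1R j2(1)] j21 by auto
    consider (eqv) "\<not> ?b" | (skip) "?b" "L j1 < L j2" | (cyc) "?b" "L j2 < L j1"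
      using ne by (meson linorder_neqE)
    then show ?thesis
    proof cases
      case eqv
      have step: "alg1_step i (arc_set R L, j1) j2 = (arc_set R L, j2)"
        using eqv large j1R j2 by (simp add: alg1_step_def Let_def)
      have eq2: "\<forall>r\<in>R. (r < c) = (r < L j2)"
      proof
        fix r assume r: "r \<in> R"
        have "L j1 \<noteq> r" "L j2 \<noteq> r" using D(4) j1R j2 r by auto
        then have "(r < L j1) = (r < L j2)" using eqv r
          by (cases r "L j1" rule: linorder_cases; cases r "L j2" rule: linorder_cases)
             (auto simp: min_def max_def not_le split: if_splits)
        then show "(r < c) = (r < L j2)" using eq r by auto
      qed
      have "?outcome js L j2"
      proof (rule IH[OF srt' setjs' M iL ic j2(2) j2(1) order.refl sm eq2 _ _ _ ex])
        show "\<forall>s\<in>R. j2 \<le> s \<and> s < j2 \<longrightarrow> L j2 < L s" by auto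
        show "\<forall>u\<in>R. \<forall>s\<in>R. j2 < s \<and> s < u \<and> L u < i \<and> (\<forall>v\<in>R. j2 < v \<and> v < u \<longrightarrow> i < L v)
            \<longrightarrow> reaches R c (L s)"
        proof (intro ballI impI, elim conjE)
          fix u s assume *: "u \<in> R" "s \<in> R" "j2 < s" "s < u" "L u < i"
            "\<forall>v\<in>R. j2 < v \<and> v < u \<longrightarrow> i < L v"
          show "reaches R c (L s)"
          proof (cases s j1 rule: linorder_cases)
            case less
            then have "L j1 < L s" using mid' * by auto
            then show ?thesis using eq by (fastforce simp: reaches_def)
          next
            case equal then show ?thesis using eq by (auto simp: reaches_def)
          next
            case greater
            have "\<forall>v\<in>R. j1 < v \<and> v < u \<longrightarrow> i < L v" using * j21 by fastforce
            then show ?thesis using hi greater * by blast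
          qed
        qed
        show "\<forall>s\<in>R. c < s \<and> s < j2 \<and> i < L s \<and> (\<forall>u\<in>R. L u < i \<longrightarrow> u < s) \<longrightarrow> reaches R c (L s)"
          if "\<forall>u\<in>R. L u < i \<longrightarrow> u < j2"
        proof -
          have "\<forall>u\<in>R. L u < i \<longrightarrow> u < j1" using that j21 by (auto intro: order.strict_trans)
          from none[OF this] show ?thesis using j2(3) by (auto intro: order.strict_trans)
        qed
      qed
      then show ?thesis using step cards by auto
    next
      case skip
      have step: "alg1_step i (arc_set R L, j1) j2 = (arc_set R L, j1)"
        using skip large j1R j2 by (simp add: alg1_step_def Let_def)
      have "?outcome js L j1"
      proof (rule IH[OF srt' setjs' M iL ic cj1 j1R less_imp_le[OF j21] ij1 eq _ hi _ ex])
        show "\<forall>s\<in>R. j2 \<le> s \<and> s < j1 \<longrightarrow> L j1 < L s"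
          using mid' skip(2) by (auto simp: le_less)
        show "\<forall>s\<in>R. c < s \<and> s < j2 \<and> i < L s \<and> (\<forall>u\<in>R. L u < i \<longrightarrow> u < s) \<longrightarrow> reaches R c (L s)"
          if "\<forall>u\<in>R. L u < i \<longrightarrow> u < j1"
          using none[OF that] j2(3) by (auto intro: order.strict_trans)
      qed
      then show ?thesis using step cards by auto
    next
      case cyc
      obtain r where r: "r \<in> R" "L j2 < r" "r < L j1" using cyc by (auto simp: min_def max_def split: if_splits)
      have rc: "r < c" using eq r by auto
      have nre: "\<not> reaches R c (L j2)" using r rc by (auto simp: reaches_def)
      \<comment> \<open>Without a large arc beyond \<open>j1\<close>, the arc at \<open>j2\<close> would end after all large arcs but start
           before \<open>c\<close>, contradicting the choice of \<open>c\<close>.\<close>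
      have "\<exists>u\<in>R. j1 < u \<and> L u < i"
      proof (rule ccontr)
        assume no: "\<not> ?thesis"
        have "u < j2" if u: "u \<in> R" "L u < i" for u
        proof -
          have "\<not> j1 < u" "u \<noteq> j1" "u \<noteq> j2" using no u ij1 sm by auto
          then show ?thesis using mid'[of u] u ij1 by (metis linorder_neqE less_trans less_asym)
        qed
        then have "\<forall>u\<in>R. L u < i \<longrightarrow> u < j1" and "\<forall>u\<in>R. L u < i \<longrightarrow> u < j2"
          using j21 by (auto intro: order.strict_trans)
        then have "reaches R c (L j2)" using none j2 sm by blast
        then show False using nre by simp
      qed
      then obtain j3 where j3: "next_large i (arc_set R L) j1 = j3" "j3 \<in> R" "j1 < j3" "L j3 < i"
        and btw: "\<And>v. v \<in> R \<Longrightarrow> j1 < v \<Longrightarrow> v < j3 \<Longrightarrow> i < L v"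
        using next_largeE[OF D(1)] small by metis
      \<comment> \<open>The cyclic move is an exchange of nested arcs at \<open>j1 < j3\<close> followed by an exchange of crossing
           arcs at \<open>j2 < j3\<close>. The numbers of third arcs involved are equal, so the two changes
           cancel.\<close>
      let ?L1 = "swap L j1 j3"
      let ?L = "swap ?L1 j2 j3"
      have L: "?L j2 = L j1" "?L j3 = L j2" "?L j1 = L j3"
        "\<And>s. s \<noteq> j1 \<Longrightarrow> s \<noteq> j2 \<Longrightarrow> s \<noteq> j3 \<Longrightarrow> ?L s = L s"
        using j21 j3 by auto
      have "arc_set R L - {(L j1, j1), (L j2, j2), (L j3, j3)} \<union> {(L j1, j2), (L j2, j3), (L j3, j1)}
          = arc_set R ?L"
        using j21 j3 j2 j1R by (auto simp: set_eq_iff swap_def)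
      then have step: "alg1_step i (arc_set R L, j1) j2 = (arc_set R ?L, j2)"
        using cyc large j1R j2(1) j3(1,2) less_not_sym[OF cyc(2)] by (simp add: alg1_step_def Let_def)
      have lt3: "L j3 < j1" using j3(4) ij1 D(3)[OF j1R] by (meson order.strict_trans)
      have M1: "matching R ?L1" using matching_swap[OF M j1R j3(2,3) lt3] .
      have j23: "j2 < j3" using j21 j3 by auto
      have lt2: "?L1 j3 < j2" using L1j2 by simp
      have M': "matching R ?L" using matching_swap[OF M1 j2(1) j3(2) j23 lt2] .
      have "rearranges i R L (swap L j3 j1)"
        by (rule rearranges_swap[OF M j3(2) j1R j3(4) ij1 lt3])
          (use j3 btw D(3)[OF j1R] in \<open>auto intro: order.strict_trans\<close>)
      then have ra1: "rearranges i R L ?L1" by (simp add: swap_commute)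
      have "rearranges i R ?L1 ?L"
        by (rule rearranges_swap_small[OF M1 j2(1) j3(2) j23 lt2]) (use sm ij1 j21 j3 in auto)
      then have R1: "rearranges i R L ?L" using ra1 rearranges_trans by blast
      have cr: "crossings R L = crossings R ?L"
      proof -
        have "crossings R ?L1 = crossings R L + 1 +
          2 * card {b \<in> R. j1 < b \<and> b < j3 \<and> L j3 < L b \<and> L b < L j1}" (is "_ = _ + _ + 2 * card ?A")
          using crossings_swap[OF M j1R j3(2,3)] j3(4) ij1 by auto
        moreover have "crossings R (swap ?L j2 j3) = crossings R ?L + 1 +
          2 * card {b \<in> R. j2 < b \<and> b < j3 \<and> ?L j3 < ?L b \<and> ?L b < ?L j2}" (is "_ = _ + _ + 2 * card ?B")
          by (rule crossings_swap[OF M' j2(1) j3(2) j23]) (use L cyc in simp)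
        moreover have "?A = ?B"
        proof -
          have "(j1 < b \<and> L j3 < L b \<and> L b < L j1) = (j2 < b \<and> ?L j3 < ?L b \<and> ?L b < ?L j2)"
            if b: "b \<in> R" "b < j3" for b
          proof (cases b j1 rule: linorder_cases)
            case less
            then show ?thesis using mid'[OF b(1)] L(1,2) L(4)[of b] b by fastforce
          next
            case equal
            then show ?thesis using L j3(4) sm by auto
          next
            case greater
            have "reaches R c (L b)" using hi j3 b greater btw by blast
            then have "L j2 < L b" using r rc by (auto simp: reaches_def intro: order.strict_trans)
            moreover have "L j3 < L b" using btw[OF b(1) greater b(2)] j3(4) by auto
            ultimately show ?thesis using greater j21 b L(1,2) L(4)[of b] by auto
          qed
          then show ?thesis by blast
        qed
        ultimately show ?thesis by simp
      qed
      have hi': "\<forall>u\<in>R. \<forall>s\<in>R. j2 < s \<and> s < u \<and> ?L u < i \<and> (\<forall>v\<in>R. j2 < v \<and> v < u \<longrightarrow> i < ?L v)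
              \<longrightarrow> reaches R c (?L s)"
      proof (intro ballI impI, elim conjE)
        fix u s assume *: "u \<in> R" "s \<in> R" "j2 < s" "s < u" "\<forall>v\<in>R. j2 < v \<and> v < u \<longrightarrow> i < ?L v"
        have "u \<le> j1" using * j1R j21 L(3) j3(4) by (metis leI less_asym)
        then have "L j1 < L s" "?L s = L s" using mid'[of s] * L(4)[of s] j3(3) by auto
        then show "reaches R c (?L s)" using eq by (fastforce simp: reaches_def)
      qed
      have Lj1: "?L j1 < i" using L j3 by simp
      have "?outcome js ?L j2"
      proof (rule IH[OF srt' setjs' M' _ ic j2(2) j2(1) order.refl _ _ _ hi'])
        show "i \<notin> ?L ` R" using iL j2 j1R j3 by simp
        show "i < ?L j2" "\<forall>r\<in>R. (r < c) = (r < ?L j2)" using ij1 eq L(1) by auto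
        show "\<forall>s\<in>R. j2 \<le> s \<and> s < j2 \<longrightarrow> ?L j2 < ?L s" by auto
        show "\<exists>u\<in>R. c < u \<and> ?L u < i" using Lj1 j1R cj1 by (intro bexI[of _ j1]) auto
        show "\<forall>s\<in>R. c < s \<and> s < j2 \<and> i < ?L s \<and> (\<forall>u\<in>R. ?L u < i \<longrightarrow> u < s) \<longrightarrow> reaches R c (?L s)"
          if "\<forall>u\<in>R. ?L u < i \<longrightarrow> u < j2" using that Lj1 j1R j21 by fastforce
      qed
      moreover have "{s \<in> set js. ?L s < i} = {s \<in> set js. L s < i}"
        using lt j21 j23 by (intro Collect_cong conj_cong refl) (metis L(4) less_asym less_irrefl)
      moreover have "?L s = L s" if "s < c" for s using that j2 cj1 j3 by (intro L(4)) auto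
      ultimately show ?thesis using step cr cards rearranges_trans[OF R1] by auto
    qed
  qed
qed

section \<open>Algorithm II\<close>

text \<open>Here the two pointers are at consecutive right-hand endpoints and the arc at the first one is
large. A large arc is thus carried to the left, and passing each small arc turns a nested pair
into a crossing pair without affecting any third arc.\<close>

lemma alg2_loop:
  fixes R :: "'a::linorder set" and L :: "'a \<Rightarrow> 'a"
  assumes "sorted_wrt (>) js" "set js = {j \<in> R. i < j \<and> j < j1}"
    and "matching R L" "i \<notin> L ` R" "i < j1" "j1 \<in> R" "L j1 < i"
  shows "\<exists>L' j. foldl (alg2_step i) (arc_set R L, j1) js = (arc_set R L', j) \<and>
     rearranges i R L L' \<and> crossings R L' = crossings R L + card {s \<in> set js. i < L s}"
    (is "?outcome js L j1")
  using assms
proof (induction js arbitrary: L j1)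
  case Nil
  then show ?case using rearranges_refl[of R L] by auto
next
  case (Cons j2 js)
  note IH = Cons.IH and srt = Cons.prems(1) and setjs = Cons.prems(2) and M = Cons.prems(3)
    and iL = Cons.prems(4) and ij1 = Cons.prems(5) and j1R = Cons.prems(6) and large = Cons.prems(7)
  note interval = descending_interval_Cons[OF srt setjs]
  note j2 = interval(1-3) and setjs' = interval(4)
  have srt': "sorted_wrt (>) js" and lt: "\<And>j. j \<in> set js \<Longrightarrow> j < j2" using srt by auto
  have gap: "\<not> (j2 < s \<and> s < j1)" if "s \<in> R" for s using interval(5)[OF that] by auto
  show ?case
  proof (cases "L j2 < i")
    case True
    have step: "alg2_step i (arc_set R L, j1) j2 = (arc_set R L, j2)"
      using True j1R j2 by (simp add: alg2_step_def Let_def)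
    have "{s \<in> set (j2 # js). i < L s} = {s \<in> set js. i < L s}" using True by auto
    then show ?thesis using IH[OF srt' setjs' M iL j2(2,1) True] step by auto
  next
    case False
    then have sm: "i < L j2" using iL j2 by (metis imageI linorder_neqE)
    let ?L = "swap L j2 j1"
    have step: "alg2_step i (arc_set R L, j1) j2 = (arc_set R ?L, j2)"
      using False j1R j2 arc_set_swap[of j1 R j2 L]
      by (simp add: alg2_step_def Let_def swap_commute)
    have lt2: "L j1 < j2" using large j2(2) by (rule order.strict_trans)
    have M': "matching R ?L" by (rule matching_swap[OF M j2(1) j1R j2(3) lt2])
    have "rearranges i R L (swap L j1 j2)"
      by (rule rearranges_swap[OF M j1R j2(1) large sm lt2])
        (use matchingD(3)[OF M j2(1)] j2(3) gap in \<open>auto intro: order.strict_trans\<close>)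
    then have R1: "rearranges i R L ?L" by (simp add: swap_commute)
    have "crossings R ?L = crossings R L + 1 +
        2 * card {b \<in> R. j2 < b \<and> b < j1 \<and> L j1 < L b \<and> L b < L j2}"
      by (rule crossings_swap[OF M j2(1) j1R j2(3)]) (use large sm in simp)
    moreover have none: "{b \<in> R. j2 < b \<and> b < j1 \<and> L j1 < L b \<and> L b < L j2} = {}"
      using gap by auto
    ultimately have cr: "crossings R ?L = crossings R L + 1" unfolding none by simp
    have "{s \<in> set (j2 # js). i < L s} = insert j2 {s \<in> set js. i < ?L s}"
    proof -
      have "?L s = L s" if "s \<in> set js" for s using lt[OF that] j2 by auto
      then show ?thesis using sm by auto
    qed
    moreover have "j2 \<notin> {s \<in> set js. i < ?L s}" using lt by auto
    moreover have "?outcome js ?L j2"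
      by (rule IH[OF srt' setjs' M' _ j2(2,1)]) (use iL j1R j2 large in simp_all)
    ultimately show ?thesis using step cr rearranges_trans[OF R1] by auto
  qed
qed

lemma set_rev_sorted_list:
  assumes "finite A"
  shows "sorted_wrt (>) (rev (sorted_list_of_set A))" "set (rev (sorted_list_of_set A)) = A"
  using assms by (auto simp: sorted_wrt_rev)

text \<open>The preprocessing gains one crossing for the small arc ending at \<open>t0\<close>; the loop then gains one
for each of the other small arcs. Both cases therefore lead to the same total, the
number of small arcs ending in \<^const>\<open>R2\<close>. The last hypothesis says that the small arcs between
\<open>t0\<close> and the next large arc do not contribute third arcs.\<close>

lemma alg2_outcome:
  fixes R :: "'a::linorder set" and L :: "'a \<Rightarrow> 'a"
  assumes M: "matching R L" and iL: "i \<notin> L ` R" and z: "\<forall>r\<in>R. r < z"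
    and t0: "t0 \<in> R" "i < t0" "R2 i z N \<noteq> {}" "Max (R2 i z N) = t0" and N: "Range N = R"
    and pre: "L t0 < i \<or> (\<exists>u\<in>R. t0 < u \<and> L u < i)"
    and reach: "\<And>u s. u \<in> R \<Longrightarrow> s \<in> R \<Longrightarrow> t0 < s \<Longrightarrow> s < u \<Longrightarrow> L u < i \<Longrightarrow>
       \<forall>v\<in>R. t0 < v \<and> v < u \<longrightarrow> i < L v \<Longrightarrow> t0 < L s"
  shows "\<exists>L'. alg2 i z N (arc_set R L) = arc_set R L' \<and> rearranges i R L L' \<and>
     crossings R L' = crossings R L + card {s \<in> R. i < s \<and> s \<le> t0 \<and> i < L s}"
proof -
  note D = matchingD[OF M]
  define A where "A = {j \<in> R. i < j \<and> j < t0}"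
  define js where "js = rev (sorted_list_of_set A)"
  have "finite A" using D(1) by (simp add: A_def)
  note js = set_rev_sorted_list[OF this, folded js_def, unfolded A_def]
  have "{j \<in> right_ends_between i z N. j < t0} = A"
    using z N by (auto simp: A_def right_ends_between_def)
  then have alg2: "alg2 i z N (arc_set R L) =
     fst (foldl (alg2_step i) (alg2_preprocess i (arc_set R L) t0, t0) js)"
    using t0(3,4) by (simp add: alg2_def js_def)
  have small: "i < L s \<longleftrightarrow> \<not> L s < i" if "s \<in> R" for s using iL that by fastforce
  show ?thesis
  proof (cases "L t0 < i")
    case True
    have "alg2_preprocess i (arc_set R L) t0 = arc_set R L"
      using True t0 by (auto simp: alg2_preprocess_def Let_def)
    moreover have "{s \<in> R. i < s \<and> s \<le> t0 \<and> i < L s} = {s \<in> set js. i < L s}"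
      unfolding js(2) using less_not_sym[OF True] by (auto simp: le_less)
    moreover obtain L' j where "foldl (alg2_step i) (arc_set R L, t0) js = (arc_set R L', j)"
      "rearranges i R L L'" "crossings R L' = crossings R L + card {s \<in> set js. i < L s}"
      using alg2_loop[OF js M iL t0(2,1) True] by blast
    ultimately show ?thesis using alg2 by (intro exI[of _ L']) simp
  next
    case False
    then have sm: "i < L t0" using small t0 by auto
    obtain u where "u \<in> R" "t0 < u" "L u < i" using pre False by auto
    from next_largeE[where R=R and L=L, OF D(1) this] obtain t1 where
      t1: "next_large i (arc_set R L) t0 = t1" "t1 \<in> R" "t0 < t1" "L t1 < i"
      "\<And>v. v \<in> R \<Longrightarrow> t0 < v \<Longrightarrow> v < t1 \<Longrightarrow> i < L v" using small by metis
    let ?L = "swap L t0 t1"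
    have pp: "alg2_preprocess i (arc_set R L) t0 = arc_set R ?L"
      using sm t0 t1 arc_set_swap[of t0 R t1 L] by (simp add: alg2_preprocess_def Let_def)
    have lt: "L t1 < t0" using t1(4) t0(2) by (rule order.strict_trans)
    have M': "matching R ?L" by (rule matching_swap[OF M t0(1) t1(2,3) lt])
    have "rearranges i R L (swap L t1 t0)"
      by (rule rearranges_swap[OF M t1(2) t0(1) t1(4) sm lt])
        (use D(3)[OF t0(1)] t1(3,5) in \<open>auto intro: order.strict_trans\<close>)
    then have R1: "rearranges i R L ?L" by (simp add: swap_commute)
    have "crossings R ?L = crossings R L + 1 +
        2 * card {b \<in> R. t0 < b \<and> b < t1 \<and> L t1 < L b \<and> L b < L t0}"
      by (rule crossings_swap[OF M t0(1) t1(2,3)]) (use t1(4) sm in simp)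
    moreover have none: "{b \<in> R. t0 < b \<and> b < t1 \<and> L t1 < L b \<and> L b < L t0} = {}"
    proof -
      have "t0 < L b" if "b \<in> R" "t0 < b" "b < t1" for b
        using reach[OF t1(2) that(1,2,3) t1(4)] t1(5) by blast
      then show ?thesis using D(3)[OF t0(1)] by fastforce
    qed
    ultimately have cr: "crossings R ?L = crossings R L + 1" unfolding none by simp
    have "{s \<in> R. i < s \<and> s \<le> t0 \<and> i < L s} = insert t0 {s \<in> set js. i < ?L s}"
    proof -
      have "?L s = L s" if "s \<in> set js" for s
      proof -
        have "s < t0" using that unfolding js(2) by simp
        then show ?thesis using t1(3) by auto
      qed
      then have *: "{s \<in> set js. i < ?L s} = {s \<in> set js. i < L s}" by auto
      show ?thesis unfolding * unfolding js(2) using sm t0(1,2) by (auto simp: le_less)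
    qed
    moreover have "t0 \<notin> {s \<in> set js. i < ?L s}" unfolding js(2) by simp
    moreover obtain L' j where "foldl (alg2_step i) (arc_set R ?L, t0) js = (arc_set R L', j)"
      "rearranges i R ?L L'" "crossings R L' = crossings R ?L + card {s \<in> set js. i < ?L s}"
    proof -
      have "i \<notin> ?L ` R" "?L t0 < i" using iL t0(1) t1 by simp_all
      then show ?thesis using alg2_loop[OF js M' _ t0(2,1)] that by blast
    qed
    moreover have "finite (set js)" by simp
    ultimately show ?thesis using alg2 pp cr rearranges_trans[OF R1]
      by (intro exI[of _ L']) simp
  qed
qed

text \<open>Write \<open>l\<^sub>1, l\<^sub>2\<close> and \<open>s\<^sub>1, s\<^sub>2\<close> for the numbers of large and small arcs ending in
\<^const>\<open>R1\<close> and \<^const>\<open>R2\<close>. The arc \<open>(i, z)\<close> crosses the \<open>l\<^sub>1 + l\<^sub>2\<close> large arcs, Algorithm I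
removes \<open>l\<^sub>1\<close> crossings and Algorithm II adds \<open>s\<^sub>2\<close>. This leaves \<open>l\<^sub>2 + s\<^sub>2\<close>, the size of
\<^const>\<open>R2\<close>, and \<^const>\<open>R2\<close> consists of the right-hand endpoints \<open>r\<close> beyond \<open>i\<close> such that the
arc reaching farthest among those that start before \<open>r\<close> is large: an arc that starts before \<open>r\<close>
and reaches beyond the critical large arc has to be small, and the critical small arc is the first
of this kind that starts before the critical large arc ends.\<close>

lemma algorithms_outcome:
  fixes R :: "'a::linorder set" and L :: "'a \<Rightarrow> 'a"
  assumes M: "matching R L" and iL: "i \<notin> L ` R" and iR: "i \<notin> R" and z: "\<forall>r\<in>R. r < z"
  defines "N \<equiv> arc_set R L"
  shows "\<exists>L'. alg2 i z N (alg1 i z N) = arc_set R L' \<and> rearranges i R L L' \<and>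
     crossings R L' + card {r \<in> R. i < r \<and> L r < i} =
     crossings R L + card {r \<in> R. i < r \<and> (\<exists>a<i. farthest R L r a)}"
proof -
  note D = matchingD[OF M]
  define Lg where "Lg = {r \<in> R. i < r \<and> L r < i}"
  define Tp where "Tp = {r \<in> R. i < r \<and> (\<exists>a<i. farthest R L r a)}"
  have finLg: "finite Lg" using D(1) by (simp add: Lg_def)
  have rb: "right_ends_between i z N = {r \<in> R. i < r}"
    using z by (auto simp: right_ends_between_def N_def)
  have lc: "large_candidates i z N = (\<lambda>r. (L r, r)) ` Lg"
    unfolding large_candidates_def rb unfolding Lg_def N_def by (auto simp: arc_set_def)
  have small: "i < L s \<longleftrightarrow> \<not> L s < i" if "s \<in> R" for s using iL that by fastforce
  have Tp_iff: "r \<in> Tp \<longleftrightarrow> r \<in> R \<and> i < r \<and> (\<exists>s\<in>Lg. \<forall>t\<in>R. L t < r \<longrightarrow> t \<le> s)" for r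
  proof
    assume "r \<in> Tp"
    then obtain s where r: "r \<in> R" "i < r" and s: "s \<in> R" "L s < i" "\<forall>t\<in>R. L t < r \<longrightarrow> t \<le> s"
      by (auto simp: Tp_def farthest_def)
    then have "r \<le> s" using D(3) by blast
    then have "s \<in> Lg" using r s by (auto simp: Lg_def)
    then show "r \<in> R \<and> i < r \<and> (\<exists>s\<in>Lg. \<forall>t\<in>R. L t < r \<longrightarrow> t \<le> s)" using r s by blast
  next
    assume "r \<in> R \<and> i < r \<and> (\<exists>s\<in>Lg. \<forall>t\<in>R. L t < r \<longrightarrow> t \<le> s)"
    then show "r \<in> Tp" by (fastforce simp: Tp_def farthest_def Lg_def)
  qed
  show ?thesis
  proof (cases "Lg = {}")
    case True
    then have "R1 i z N = {}" "R2 i z N = {}" by (simp_all add: R1_def R2_def small_candidates_def lc)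
    then have "alg2 i z N (alg1 i z N) = arc_set R L" by (simp add: alg1_def alg2_def N_def)
    moreover have "Tp = {}" using Tp_iff True by blast
    ultimately show ?thesis using rearranges_refl[OF M] True unfolding Lg_def[symmetric] Tp_def[symmetric]
      by auto
  next
    case False
    define b where "b = Max Lg"
    have "b \<in> Lg" using Max_in[OF finLg False] by (simp add: b_def)
    then have b: "b \<in> R" "i < b" "L b < i" by (auto simp: Lg_def)
    have bmax: "s \<le> b" if "s \<in> Lg" for s using Max_ge[OF finLg that] by (simp add: b_def)
    have snd: "snd ` large_candidates i z N = Lg" by (auto simp: lc image_image)
    have cl: "critical_large i z N = (L b, b)"
      unfolding critical_large_def snd by (simp add: b_def[symmetric] Let_def b(1) N_def)
    have Tp_iff': "r \<in> Tp \<longleftrightarrow> r \<in> R \<and> i < r \<and> (\<forall>t\<in>R. L t < r \<longrightarrow> t \<le> b)" for r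
      unfolding Tp_iff using bmax \<open>b \<in> Lg\<close> by (meson order.trans)
    define Sm where "Sm = {r \<in> R. i < L r \<and> L r < b \<and> b < r}"
    have sc: "small_candidates i z N = (\<lambda>r. (L r, r)) ` Sm"
    proof -
      have "small_candidates i z N = {e \<in> N. i < fst e \<and> crosses e (L b, b)}"
        using False by (simp add: small_candidates_def lc cl)
      also have "\<dots> = (\<lambda>r. (L r, r)) ` Sm"
        unfolding Sm_def N_def crosses_def arc_set_def using b(3) by (auto simp: image_iff)
      finally show ?thesis .
    qed
    show ?thesis
    proof (cases "Sm = {}")
      case True
      have "R1 i z N = {}" by (simp add: R1_def sc True)
      then have alg1: "alg1 i z N = arc_set R L" by (simp add: alg1_def N_def)
      have R2: "R2 i z N = {r \<in> R. i < r \<and> r \<le> b}"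
        using False by (auto simp: R2_def sc lc True cl rb)
      have "finite {r \<in> R. i < r \<and> r \<le> b}" using D(1) by simp
      then have mx: "Max (R2 i z N) = b" "R2 i z N \<noteq> {}" unfolding R2 using b by (auto intro!: Max_eqI)
      have "\<exists>L'. alg2 i z N (arc_set R L) = arc_set R L' \<and> rearranges i R L L' \<and>
          crossings R L' = crossings R L + card {s \<in> R. i < s \<and> s \<le> b \<and> i < L s}"
      proof (rule alg2_outcome[OF M iL z b(1,2) mx(2,1)])
        show "Range N = R" by (simp add: N_def)
        show "L b < i \<or> (\<exists>u\<in>R. b < u \<and> L u < i)" using b by simp
        fix u s assume *: "u \<in> R" "b < s" "s < u" "L u < i"
        then have "b < u" by (auto intro: order.strict_trans)
        then have "u \<in> Lg" using b(2) * by (auto simp: Lg_def intro: order.strict_trans)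
        then show "b < L s" using bmax[of u] \<open>b < u\<close> by auto
      qed
      moreover have "Tp = {r \<in> R. i < r \<and> r \<le> b}"
      proof (intro set_eqI iffI)
        fix r assume "r \<in> Tp"
        then show "r \<in> {r \<in> R. i < r \<and> r \<le> b}" using Tp_iff' D(3) by blast
      next
        fix r assume r: "r \<in> {r \<in> R. i < r \<and> r \<le> b}"
        have "t \<le> b" if t: "t \<in> R" "L t < r" for t
        proof (rule ccontr)
          assume "\<not> t \<le> b"
          then have "t \<notin> Lg" "b < t" using bmax[of t] by auto
          then have "t \<in> Sm" using t r b small[of t] by (auto simp: Lg_def Sm_def)
          then show False using True by simp
        qed
        then show "r \<in> Tp" using Tp_iff' r by blast
      qed
      moreover have "card {r \<in> R. i < r \<and> r \<le> b} = card Lg + card {s \<in> R. i < s \<and> s \<le> b \<and> i < L s}"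
      proof -
        have "{r \<in> R. i < r \<and> r \<le> b} = Lg \<union> {s \<in> R. i < s \<and> s \<le> b \<and> i < L s}"
          using bmax small by (auto simp: Lg_def)
        moreover have "Lg \<inter> {s \<in> R. i < s \<and> s \<le> b \<and> i < L s} = {}" by (auto simp: Lg_def)
        ultimately show ?thesis using finLg D(1) by (simp add: card_Un_disjoint)
      qed
      ultimately show ?thesis unfolding Lg_def[symmetric] Tp_def[symmetric] alg1 by force
    next
      case Sm: False
      define c where "c = Min (L ` Sm)"
      have finSm: "finite Sm" using D(1) by (simp add: Sm_def)
      have "c \<in> L ` Sm" unfolding c_def using finSm Sm by (intro Min_in) auto
      then obtain t where t: "t \<in> Sm" "L t = c" by auto
      then have tR: "t \<in> R" "i < c" "c < b" "b < t" by (auto simp: Sm_def)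
      have cmin: "c \<le> L s" if "s \<in> Sm" for s using finSm that by (auto simp: c_def)
      have "right_end N c = t"
        unfolding right_end_def N_def using t tR D(5) by (intro the_equality) auto
      moreover have "fst ` small_candidates i z N = L ` Sm" by (auto simp: sc image_image)
      ultimately have cs: "critical_small i z N = (c, t)"
        by (simp add: critical_small_def c_def[symmetric] Let_def)
      have R1: "R1 i z N = {j \<in> R. c < j \<and> j \<le> t}"
        using Sm tR(2) by (auto simp: R1_def sc cs rb)
      have R2: "R2 i z N = {j \<in> R. i < j \<and> j < c}"
        using Sm False by (auto simp: R2_def sc lc cs rb)
      define js where "js = rev (sorted_list_of_set {j \<in> R. c < j \<and> j < t})"
      have "finite {j \<in> R. c < j \<and> j < t}" using D(1) by simp
      note js = set_rev_sorted_list[OF this, folded js_def]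
      have ct: "c < t" "i < L t" using tR t by (auto intro: order.strict_trans)
      have "t \<in> R1 i z N" unfolding R1 using tR(1) ct by simp
      then have ne: "R1 i z N \<noteq> {}" by blast
      have below: "{j \<in> R1 i z N. j < t} = {j \<in> R. c < j \<and> j < t}" unfolding R1 by auto
      have alg1: "alg1 i z N = fst (foldl (alg1_step i) (arc_set R L, t) js)"
        unfolding alg1_def Let_def cs snd_conv below js_def[symmetric] if_not_P[OF ne] by (simp only: N_def)
      have tLg: "u < t" if "u \<in> R" "L u < i" for u
      proof (cases "i < u")
        case True then show ?thesis using bmax[of u] that tR by (auto simp: Lg_def)
      next
        case False then show ?thesis using tR by auto
      qed
      have "\<exists>L' j. foldl (alg1_step i) (arc_set R L, t) js = (arc_set R L', j) \<and>
         rearranges i R L L' \<and> (\<forall>s\<in>R. s < c \<longrightarrow> L' s = L s) \<and> (\<exists>u\<in>R. c < u \<and> L' u < i) \<and>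
         crossings R L = crossings R L' + card {s \<in> set js. L s < i} \<and>
         (\<forall>u\<in>R. \<forall>s\<in>R. c < s \<and> s < u \<and> L' u < i \<and> (\<forall>v\<in>R. c < v \<and> v < u \<longrightarrow> i < L' v)
            \<longrightarrow> reaches R c (L' s))"
      proof (rule alg1_loop[OF js M iL tR(2) ct(1) tR(1) order.refl ct(2)])
        show "\<forall>r\<in>R. (r < c) = (r < L t)" using t by simp
        show "\<forall>s\<in>R. t \<le> s \<and> s < t \<longrightarrow> L t < L s" by auto
        show "\<forall>u\<in>R. \<forall>s\<in>R. t < s \<and> s < u \<and> L u < i \<and> (\<forall>v\<in>R. t < v \<and> v < u \<longrightarrow> i < L v)
            \<longrightarrow> reaches R c (L s)" using tLg by fastforce
        show "\<exists>u\<in>R. c < u \<and> L u < i" using b tR by auto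
        have "reaches R c (L s)" if s: "s \<in> R" "i < L s" "\<forall>u\<in>R. L u < i \<longrightarrow> u < s" for s
        proof -
          have "b < s" using s b by auto
          then have "c \<le> L s" using s cmin[of s] tR(3) by (cases "L s < b") (auto simp: Sm_def)
          then show ?thesis by (auto simp: reaches_def)
        qed
        then show "\<forall>s\<in>R. c < s \<and> s < t \<and> i < L s \<and> (\<forall>u\<in>R. L u < i \<longrightarrow> u < s) \<longrightarrow> reaches R c (L s)"
          by blast
      qed
      then obtain L1 j where fold: "foldl (alg1_step i) (arc_set R L, t) js = (arc_set R L1, j)"
        and L1: "rearranges i R L L1"
        "\<And>s. s \<in> R \<Longrightarrow> s < c \<Longrightarrow> L1 s = L s" "\<exists>u\<in>R. c < u \<and> L1 u < i"
        "crossings R L = crossings R L1 + card {s \<in> set js. L s < i}"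
        "\<forall>u\<in>R. \<forall>s\<in>R. c < s \<and> s < u \<and> L1 u < i \<and> (\<forall>v\<in>R. c < v \<and> v < u \<longrightarrow> i < L1 v)
            \<longrightarrow> reaches R c (L1 s)"
        by blast
      note alg1 = alg1[unfolded fold fst_conv]
      have M1: "matching R L1" and im: "L1 ` R = L ` R" using L1(1) by (auto simp: rearranges_def)
      have iL1: "i \<notin> L1 ` R" using iL im by simp
      have nc: "r \<noteq> c" if "r \<in> R" for r using D(4)[OF tR(1) that] t by auto
      have "\<exists>L'. alg2 i z N (arc_set R L1) = arc_set R L' \<and> rearranges i R L1 L' \<and>
         crossings R L' = crossings R L1 + card {s \<in> R2 i z N. i < L s}"
      proof (cases "R2 i z N = {}")
        case True
        then show ?thesis using rearranges_refl[OF M1] by (auto simp: alg2_def)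
      next
        case ne: False
        define t0 where "t0 = Max (R2 i z N)"
        have fin2: "finite (R2 i z N)" unfolding R2 using D(1) by simp
        have "t0 \<in> R2 i z N" unfolding t0_def by (rule Max_in[OF fin2 ne])
        then have t0: "t0 \<in> R" "i < t0" "t0 < c" by (auto simp: R2)
        have gap: "c < s" if "s \<in> R" "t0 < s" for s
        proof (rule ccontr)
          assume "\<not> c < s"
          then have "s \<in> R2 i z N" using that nc[of s] t0 by (auto simp: R2)
          then have "s \<le> t0" using fin2 by (simp add: t0_def)
          then show False using that by simp
        qed
        have "\<exists>L'. alg2 i z N (arc_set R L1) = arc_set R L' \<and> rearranges i R L1 L' \<and>
           crossings R L' = crossings R L1 + card {s \<in> R. i < s \<and> s \<le> t0 \<and> i < L1 s}"
        proof (rule alg2_outcome[OF M1 iL1 z t0(1,2) ne t0_def[symmetric]])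
          show "Range N = R" by (simp add: N_def)
          show "L1 t0 < i \<or> (\<exists>u\<in>R. t0 < u \<and> L1 u < i)" using L1(3) t0 by (auto intro: order.strict_trans)
          fix u s assume *: "u \<in> R" "s \<in> R" "t0 < s" "s < u" "L1 u < i"
            "\<forall>v\<in>R. t0 < v \<and> v < u \<longrightarrow> i < L1 v"
          have "\<forall>v\<in>R. c < v \<and> v < u \<longrightarrow> i < L1 v" using *(6) t0(3) by (meson order.strict_trans)
          then have "reaches R c (L1 s)" using L1(5) * gap by blast
          then show "t0 < L1 s" using t0 by (auto simp: reaches_def)
        qed
        moreover have "{s \<in> R. i < s \<and> s \<le> t0 \<and> i < L1 s} = {s \<in> R2 i z N. i < L s}"
        proof -
          have "s \<le> t0 \<longleftrightarrow> s < c" if "s \<in> R" for s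
            using gap[OF that] t0(3) by (meson leI le_less_trans less_asym)
          then show ?thesis using L1(2) by (auto simp: R2)
        qed
        ultimately show ?thesis by simp
      qed
      then obtain L' where L': "alg2 i z N (arc_set R L1) = arc_set R L'" "rearranges i R L1 L'"
         "crossings R L' = crossings R L1 + card {s \<in> R2 i z N. i < L s}" by blast
      have "Tp = R2 i z N"
      proof (intro set_eqI iffI)
        fix r assume "r \<in> Tp"
        then have r: "r \<in> R" "i < r" "\<forall>t\<in>R. L t < r \<longrightarrow> t \<le> b" using Tp_iff' by auto
        then have "\<not> L t < r" using tR by auto
        then show "r \<in> R2 i z N" using r t nc[of r] by (auto simp: R2)
      next
        fix r assume r: "r \<in> R2 i z N"
        have "s \<le> b" if s: "s \<in> R" "L s < r" for s
        proof (rule ccontr)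
          assume "\<not> s \<le> b"
          then have "s \<notin> Lg" "b < s" using bmax[of s] by auto
          moreover have "L s < c" using s r by (auto simp: R2)
          ultimately have "s \<in> Sm" using s b tR small[of s] by (auto simp: Lg_def Sm_def)
          then show False using cmin[of s] \<open>L s < c\<close> by simp
        qed
        then show "r \<in> Tp" using Tp_iff' r by (auto simp: R2)
      qed
      moreover have "card (R2 i z N) + card {s \<in> set js. L s < i}
          = card Lg + card {s \<in> R2 i z N. i < L s}"
      proof -
        have e1: "R2 i z N = {s \<in> R2 i z N. L s < i} \<union> {s \<in> R2 i z N. i < L s}"
          using small by (auto simp: R2)
        have e2: "Lg = {s \<in> R2 i z N. L s < i} \<union> {s \<in> set js. L s < i}"
          using nc tLg tR(2) unfolding Lg_def R2 js(2)
          by (auto intro: order.strict_trans) (metis linorder_neqE)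
        have "card (R2 i z N) = card {s \<in> R2 i z N. L s < i} + card {s \<in> R2 i z N. i < L s}"
          by (subst e1, rule card_Un_disjoint) (use D(1) in \<open>auto simp: R2\<close>)
        moreover have "card Lg = card {s \<in> R2 i z N. L s < i} + card {s \<in> set js. L s < i}"
          unfolding js(2) R2
          by (subst e2[unfolded js(2) R2], rule card_Un_disjoint) (use D(1) in auto)
        ultimately show ?thesis by simp
      qed
      ultimately show ?thesis using L' alg1 L1(4) rearranges_trans[OF L1(1) L'(2)]
        unfolding Lg_def[symmetric] Tp_def[symmetric] by (intro exI[of _ L']) simp
    qed
  qed
qed

section \<open>The statistic pmaj as a sum of ascents\<close>

definition ascents :: "'a::linorder list \<Rightarrow> nat" where
  "ascents w = card {k. Suc k < length w \<and> w ! k < w ! Suc k}"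

lemma ascents_snoc: "ascents (w @ [x]) = ascents w + of_bool (w \<noteq> [] \<and> last w < x)"
proof -
  let ?I = "{k. Suc k < length w \<and> w ! k < w ! Suc k}"
  have "{k. Suc k < length (w @ [x]) \<and> (w @ [x]) ! k < (w @ [x]) ! Suc k} =
    ?I \<union> (if w \<noteq> [] \<and> last w < x then {length w - 1} else {})" (is "?J = ?K")
  proof (intro set_eqI)
    fix k
    consider "Suc k < length w" | "Suc k = length w" | "length w < Suc k" by linarith
    then show "k \<in> ?J \<longleftrightarrow> k \<in> ?K"
    proof cases
      case 2
      then have "w \<noteq> []" "k = length w - 1" by auto
      then show ?thesis using 2 by (simp add: nth_append last_conv_nth)
    qed (auto simp: nth_append)
  qed
  moreover have "finite ?I" by (rule finite_subset[of _ "{..<length w}"]) auto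
  ultimately show ?thesis by (auto simp: ascents_def)
qed

lemma ascents_map_mono:
  assumes "\<And>x y. x \<in> set xs \<Longrightarrow> y \<in> set xs \<Longrightarrow> f x < f y \<longleftrightarrow> g x < g y"
  shows "ascents (map f xs) = ascents (map g xs)"
  unfolding ascents_def using assms by (intro arg_cong[of _ _ card] Collect_cong) auto

text \<open>The arcs present in the word attached to \<open>r\<close>, each represented by its right-hand endpoint, in the
order in which their labels appear. Labels decrease as left-hand endpoints grow, so the
descents of that word are the ascents of the list of left-hand endpoints.\<close>

definition arcs_over :: "'a::linorder set \<Rightarrow> ('a \<Rightarrow> 'a) \<Rightarrow> 'a \<Rightarrow> 'a list" where
  "arcs_over R L r = sorted_list_of_set {s \<in> R. r \<le> s \<and> L s < r}"

definition ascent_sum :: "'a::linorder set \<Rightarrow> ('a \<Rightarrow> 'a) \<Rightarrow> nat" where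
  "ascent_sum R L = (\<Sum>r\<in>R. ascents (map L (arcs_over R L r)))"

lemma sorted_list_of_set_eqI:
  "finite A \<Longrightarrow> sorted_wrt (<) xs \<Longrightarrow> set xs = A \<Longrightarrow> sorted_list_of_set A = xs"
  by (rule strict_sorted_equal) auto

lemma filter_sorted_list_of_set:
  "finite A \<Longrightarrow> filter P (sorted_list_of_set A) = sorted_list_of_set {x \<in> A. P x}"
  by (rule sorted_list_of_set_eqI[symmetric]) (auto intro: sorted_wrt_filter)

lemma le_last: "sorted xs \<Longrightarrow> x \<in> set xs \<Longrightarrow> x \<le> last xs"
  by (induction xs rule: rev_induct) (auto simp: sorted_append)

lemma farthest_insert_max:
  assumes "\<forall>r\<in>R. r < z"
  shows "farthest (insert z R) L p a \<longleftrightarrow> (if L z < p then a = L z else farthest R L p a)"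
  using assms unfolding farthest_def by (auto simp: not_le[symmetric] intro: less_imp_le)

text \<open>The new arc is appended to the word of every \<open>r\<close> between its endpoints. It creates an ascent
exactly if the previous last letter is smaller, and that letter belongs to the arc reaching
farthest among those that start before \<open>r\<close>.\<close>

lemma ascent_sum_insert_max:
  assumes fin: "finite R" and lt: "\<forall>r\<in>insert z R. L r < r" and z: "\<forall>r\<in>R. r < z"
  shows "ascent_sum (insert z R) L =
    ascent_sum R L + card {r \<in> R. L z < r \<and> (\<exists>a<L z. farthest R L r a)}"
proof -
  have zR: "z \<notin> R" using z by auto
  have last: "arcs_over (insert z R) L z = [z]"
    unfolding arcs_over_def using z lt fin by (intro sorted_list_of_set_eqI) auto
  have eq: "ascents (map L (arcs_over (insert z R) L r)) =
      ascents (map L (arcs_over R L r)) + of_bool (L z < r \<and> (\<exists>a<L z. farthest R L r a))"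
    if r: "r \<in> R" for r
  proof -
    let ?xs = "arcs_over R L r"
    let ?X = "{s \<in> R. r \<le> s \<and> L s < r}"
    have srt: "sorted_wrt (<) ?xs" and set: "set ?xs = ?X"
      using fin by (auto simp: arcs_over_def)
    show ?thesis
    proof (cases "L z < r")
      case True
      have over: "arcs_over (insert z R) L r = ?xs @ [z]"
        unfolding arcs_over_def[of "insert z R"]
        by (rule sorted_list_of_set_eqI) (use fin srt set True r z in \<open>auto simp: sorted_wrt_append intro: less_imp_le\<close>)
      have "r \<in> set ?xs" using set r lt by auto
      then have ne: "?xs \<noteq> []" by auto
      let ?m = "last ?xs"
      have m: "?m \<in> ?X" using last_in_set[OF ne] set by blast
      have max: "s \<le> ?m" if "s \<in> ?X" for s
        using le_last[OF strict_sorted_imp_sorted[OF srt]] that set by blast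
      have "farthest R L r a \<longleftrightarrow> a = L ?m" for a
      proof
        assume "farthest R L r a"
        then obtain s where s: "s \<in> R" "L s = a" "a < r" "\<forall>t\<in>R. L t < r \<longrightarrow> t \<le> s"
          by (auto simp: farthest_def)
        then have "s \<in> ?X" "?m \<le> s" using r lt m by auto
        then show "a = L ?m" using max[of s] s by auto
      next
        assume a: "a = L ?m"
        have "t \<le> ?m" if "t \<in> R" "L t < r" for t
        proof (cases "r \<le> t")
          case True then show ?thesis using that max by blast
        next
          case False then show ?thesis using m by auto
        qed
        then show "farthest R L r a" unfolding farthest_def using a m by (intro bexI[of _ ?m]) auto
      qed
      moreover have "last (map L ?xs) = L ?m" by (rule last_map[OF ne])
      ultimately show ?thesis using True ne by (auto simp: over ascents_snoc)
    next
      case False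
      then have "{s \<in> insert z R. r \<le> s \<and> L s < r} = ?X" by auto
      then show ?thesis using False by (simp add: arcs_over_def)
    qed
  qed
  have "ascent_sum (insert z R) L = (\<Sum>r\<in>R. ascents (map L (arcs_over (insert z R) L r)))"
    unfolding ascent_sum_def using fin zR last by (simp add: ascents_def)
  also have "\<dots> = (\<Sum>r\<in>R. ascents (map L (arcs_over R L r)) + of_bool (L z < r \<and> (\<exists>a<L z. farthest R L r a)))"
    using eq by (intro sum.cong) auto
  also have "\<dots> = ascent_sum R L + card {r \<in> R. L z < r \<and> (\<exists>a<L z. farthest R L r a)}"
    using fin by (simp add: sum.distrib ascent_sum_def Int_def)
  finally show ?thesis .
qed

lemma arc_label_arc_set:
  "arc_label (arc_set R L) (L s, s) = card {t \<in> R. L s \<le> L t}"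
proof -
  have "{f \<in> arc_set R L. fst (L s, s) \<le> fst f} = (\<lambda>r. (L r, r)) ` {t \<in> R. L s \<le> L t}"
    by (auto simp: arc_set_def)
  moreover have "inj_on (\<lambda>r. (L r, r)) {t \<in> R. L s \<le> L t}" by (auto simp: inj_on_def)
  ultimately show ?thesis by (simp add: arc_label_def card_image)
qed

lemma label_less_iff:
  fixes L :: "'a \<Rightarrow> 'b::linorder"
  assumes "finite R" "s \<in> R" "t \<in> R"
  shows "card {u \<in> R. L s \<le> L u} > card {u \<in> R. L t \<le> L u} \<longleftrightarrow> L s < L t"
proof
  assume "L s < L t"
  then have "{u \<in> R. L t \<le> L u} \<subseteq> {u \<in> R. L s \<le> L u}"
    and "s \<in> {u \<in> R. L s \<le> L u} - {u \<in> R. L t \<le> L u}"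
    using assms by auto
  then have "{u \<in> R. L t \<le> L u} \<subset> {u \<in> R. L s \<le> L u}" by blast
  then show "card {u \<in> R. L s \<le> L u} > card {u \<in> R. L t \<le> L u}"
    using assms by (intro psubset_card_mono) auto
next
  assume *: "card {u \<in> R. L s \<le> L u} > card {u \<in> R. L t \<le> L u}"
  show "L s < L t"
  proof (rule ccontr)
    assume "\<not> L s < L t"
    then have "{u \<in> R. L s \<le> L u} \<subseteq> {u \<in> R. L t \<le> L u}" by auto
    then have "card {u \<in> R. L s \<le> L u} \<le> card {u \<in> R. L t \<le> L u}"
      using assms by (intro card_mono) auto
    then show False using * by simp
  qed
qed

text \<open>Passing from a right-hand endpoint \<open>r\<close> to the next smaller one \<open>r'\<close>, the arcs that have to leave
the word are those that start between the two, and the only new one ends at \<open>r'\<close>, which puts it first.\<close>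

lemma sigma_arc_set:
  assumes A: "arc_system R L" and k: "k < card R"
  defines "label \<equiv> \<lambda>s. card {t \<in> R. L s \<le> L t}"
  shows "sigma (arc_set R L) k = map label (arcs_over R L (right_ends_desc (arc_set R L) ! k))"
  using k
proof (induction k)
  have fin: "finite R" and inj: "inj_on L R" and lt: "\<And>r. r \<in> R \<Longrightarrow> L r < r"
    using A by (auto simp: arc_system_def)
  define rs where "rs = rev (sorted_list_of_set R)"
  have rs: "sorted_wrt (>) rs" "set rs = R" "length rs = card R"
    using fin by (auto simp: rs_def sorted_wrt_rev)
  have desc: "right_ends_desc (arc_set R L) = rs" by (simp add: right_ends_desc_def rs_def)
  have mem: "rs ! k \<in> R" if "k < card R" for k using nth_mem[of k rs] that unfolding rs(2,3) .
  have label: "arc_label (arc_set R L) (left_end (arc_set R L) r, r) = label r" if "r \<in> R" for r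
    using that by (simp add: arc_label_arc_set label_def)
  {
    case 0
    let ?r = "rs ! 0"
    have r: "?r \<in> R" using mem 0 by simp
    have "s \<le> ?r" if s: "s \<in> R" for s
    proof -
      obtain k where "k < length rs" "s = rs ! k" using s unfolding rs(2)[symmetric] in_set_conv_nth by blast
      then show ?thesis using rs(1) by (cases "k = 0") (auto simp: sorted_wrt_iff_nth_less less_imp_le)
    qed
    then have "{s \<in> R. ?r \<le> s \<and> L s < ?r} = {?r}" using r lt by force
    then show ?case using r label by (simp add: desc arcs_over_def Let_def)
  next
    case (Suc k)
    let ?r = "rs ! k" and ?r' = "rs ! Suc k"
    have r: "?r \<in> R" "?r' \<in> R" using mem Suc.prems by auto
    have r'r: "?r' < ?r" using rs Suc.prems by (simp add: sorted_wrt_iff_nth_less)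
    have gap: "?r \<le> s" if s: "s \<in> R" "?r' < s" for s
    proof -
      obtain l where l: "l < length rs" "s = rs ! l" using s(1) unfolding rs(2)[symmetric] in_set_conv_nth by blast
      have "\<not> Suc k < l" "l \<noteq> Suc k"
        using rs(1) l s by (auto simp: sorted_wrt_iff_nth_less dest: less_asym)
      then show ?thesis using rs(1) l Suc.prems rs(3)
        by (cases "l = k") (auto simp: sorted_wrt_iff_nth_less less_imp_le)
    qed
    let ?D = "arc_label (arc_set R L) ` {e \<in> arc_set R L. ?r' \<le> fst e \<and> fst e < ?r}"
    have D: "?D = label ` {s \<in> R. ?r' \<le> L s \<and> L s < ?r}"
    proof -
      have "{e \<in> arc_set R L. ?r' \<le> fst e \<and> fst e < ?r} =
          (\<lambda>s. (L s, s)) ` {s \<in> R. ?r' \<le> L s \<and> L s < ?r}"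
        by (auto simp: arc_set_def)
      then show ?thesis by (simp only: image_image arc_label_arc_set label_def)
    qed
    have keep: "label s \<notin> ?D \<longleftrightarrow> L s < ?r'" if s: "s \<in> set (arcs_over R L ?r)" for s
    proof -
      have s': "s \<in> R" "L s < ?r" using s fin by (auto simp: arcs_over_def)
      have eq: "L s = L t" if "t \<in> R" "label s = label t" for t
        using label_less_iff[OF fin s'(1) that(1), of L] label_less_iff[OF fin that(1) s'(1), of L]
          that(2) unfolding label_def by (cases "L s" "L t" rule: linorder_cases) simp_all
      show ?thesis
      proof
        assume "label s \<notin> ?D"
        then have "s \<notin> {s \<in> R. ?r' \<le> L s \<and> L s < ?r}" unfolding D by blast
        then show "L s < ?r'" using s' by simp
      next
        assume small: "L s < ?r'"
        show "label s \<notin> ?D"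
        proof
          assume "label s \<in> ?D"
          then obtain t where "t \<in> R" "?r' \<le> L t" "label s = label t" unfolding D by blast
          then show False using eq[of t] small by simp
        qed
      qed
    qed
    have "sigma (arc_set R L) (Suc k) =
        label ?r' # filter (\<lambda>a. a \<notin> ?D) (map label (arcs_over R L ?r))"
      using Suc.IH Suc.prems label[OF r(2)] by (simp add: desc Let_def)
    also have "filter (\<lambda>a. a \<notin> ?D) (map label (arcs_over R L ?r)) =
        map label (filter (\<lambda>s. L s < ?r') (arcs_over R L ?r))"
      unfolding filter_map using keep by (intro arg_cong[of _ _ "map label"] filter_cong) auto
    also have "filter (\<lambda>s. L s < ?r') (arcs_over R L ?r) =
        sorted_list_of_set {s \<in> R. ?r \<le> s \<and> L s < ?r'}"
      unfolding arcs_over_def using fin r'r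
      by (subst filter_sorted_list_of_set) (auto intro!: arg_cong[of _ _ sorted_list_of_set] intro: order.strict_trans)
    also have "label ?r' # map label \<dots> = map label (arcs_over R L ?r')"
    proof -
      have "arcs_over R L ?r' = ?r' # sorted_list_of_set {s \<in> R. ?r \<le> s \<and> L s < ?r'}"
        unfolding arcs_over_def using fin gap r r'r lt
        by (intro sorted_list_of_set_eqI) (auto simp: le_less intro: order.strict_trans)
      then show ?thesis by simp
    qed
    finally show ?case by (simp add: desc)
  }
qed

lemma des_map_label:
  assumes "finite R" "set xs \<subseteq> R"
  shows "des (map (\<lambda>s. card {t \<in> R. L s \<le> L t}) xs) = ascents (map L xs)"
proof -
  have "(card {t \<in> R. L (xs ! Suc k) \<le> L t} < card {t \<in> R. L (xs ! k) \<le> L t}) =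
     (L (xs ! k) < L (xs ! Suc k))" if "Suc k < length xs" for k
    using assms that by (intro label_less_iff) (auto simp: subset_iff)
  then show ?thesis unfolding des_def ascents_def
    by (intro arg_cong[of _ _ card] Collect_cong) auto
qed

lemma pmaj_eq_ascent_sum:
  assumes P: "arcs P = arc_set R L" and A: "arc_system R L"
  shows "pmaj P = ascent_sum R L"
proof -
  have fin: "finite R" using A by (simp add: arc_system_def)
  let ?rs = "rev (sorted_list_of_set R)"
  have "pmaj P = (\<Sum>k<card R. ascents (map L (arcs_over R L (?rs ! k))))"
    unfolding pmaj_def P card_arc_set
  proof (intro sum.cong refl)
    fix k assume "k \<in> {..<card R}"
    then have "sigma (arc_set R L) k = map (\<lambda>s. card {t \<in> R. L s \<le> L t}) (arcs_over R L (?rs ! k))"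
      using sigma_arc_set[OF A] by (simp add: right_ends_desc_def)
    moreover have "set (arcs_over R L (?rs ! k)) \<subseteq> R" using fin by (auto simp: arcs_over_def)
    ultimately show "des (sigma (arc_set R L) k) = ascents (map L (arcs_over R L (?rs ! k)))"
      using des_map_label[OF fin] by simp
  qed
  also have "\<dots> = ascent_sum R L" unfolding ascent_sum_def
    by (rule sum.reindex_bij_betw, rule bij_betw_nth) (use fin in auto)
  finally show ?thesis .
qed

section \<open>The map phi turns ascents into crossings\<close>

text \<open>The number of large arcs that end after \<open>i\<close> depends on the two sets of endpoints only: every arc
that ends before \<open>i\<close> starts before \<open>i\<close>.\<close>

lemma card_large_eq:
  assumes "matching R L" "matching R L'" "L' ` R = L ` R"
  shows "card {r \<in> R. i < r \<and> L' r < i} = card {r \<in> R. i < r \<and> L r < i}"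
proof -
  have "card {r \<in> R. i < r \<and> F r < i} + card {r \<in> R. r \<le> i} = card (F ` R \<inter> {..<i})"
    if F: "matching R F" for F
  proof -
    note D = matchingD[OF F]
    have "{r \<in> R. F r < i} = {r \<in> R. i < r \<and> F r < i} \<union> {r \<in> R. r \<le> i}"
      using D(3) by (auto intro: order.strict_trans2)
    moreover have "{r \<in> R. i < r \<and> F r < i} \<inter> {r \<in> R. r \<le> i} = {}" by auto
    ultimately have "card {r \<in> R. F r < i} = card {r \<in> R. i < r \<and> F r < i} + card {r \<in> R. r \<le> i}"
      using D(1) by (simp add: card_Un_disjoint)
    moreover have "F ` R \<inter> {..<i} = F ` {r \<in> R. F r < i}" by auto
    moreover have "inj_on F {r \<in> R. F r < i}" using D(2) by (rule inj_on_subset) auto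
    ultimately show ?thesis by (simp add: card_image)
  qed
  from this[OF assms(1)] this[OF assms(2)] show ?thesis using assms(3) by simp
qed

lemma crossings_insert_max:
  assumes "finite R" "\<forall>r\<in>R. r < z"
  shows "crossings (insert z R) L = crossings R L + card {r \<in> R. L z < r \<and> L r < L z}"
proof -
  have "z \<notin> R" using assms by auto
  moreover have "(\<Sum>b\<in>R. of_bool (crossing L b z) + of_bool (crossing L z b)) =
      (\<Sum>b\<in>R. of_bool (L z < b \<and> L b < L z) :: nat)"
    using assms(2) by (intro sum.cong refl) (auto simp: crossing_def)
  ultimately show ?thesis using assms(1) by (simp add: crossings_insert Int_def)
qed

text \<open>The invariance of \<^term>\<open>farthest\<close> is what makes the induction work: the gain of pmaj is
computed in the matching without its last arc and the gain of crossings in the image of that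
matching, and the two must agree on which right-hand endpoints count.\<close>

lemma phi_rec_arc_set:
  fixes R :: "'a::linorder set"
  assumes "matching R L" "card R = m"
  shows "\<exists>L'. phi_rec m (arc_set R L) = arc_set R L' \<and> matching R L' \<and> L' ` R = L ` R \<and>
    crossings R L' = ascent_sum R L \<and> (\<forall>p a. farthest R L' p a = farthest R L p a)"
  using assms
proof (induction m arbitrary: R)
  case 0
  then have "R = {}" using matchingD(1)[OF 0(1)] by simp
  then show ?case using 0 by (intro exI[of _ L]) (auto simp: crossings_def ascent_sum_def)
next
  case (Suc m)
  note M = Suc.prems(1)
  note D = matchingD[OF M]
  define z where "z = Max R"
  define R' where "R' = R - {z}"
  have "R \<noteq> {}" using Suc.prems(2) by auto
  then have zR: "z \<in> R" using D(1) by (simp add: z_def)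
  then have R: "R = insert z R'" by (auto simp: R'_def)
  have fin: "finite R'" and zn: "z \<notin> R'" using D(1) by (auto simp: R'_def)
  have z: "\<forall>r\<in>R'. r < z" using D(1) by (auto simp: R'_def z_def order.strict_iff_order)
  have card: "card R' = m" using Suc.prems(2) R fin zn by simp
  have M': "matching R' L" using M by (auto simp: matching_def arc_system_def R'_def inj_on_def)
  let ?i = "L z"
  have iR: "?i \<notin> R'" "?i \<notin> L ` R'" using D zR by (auto simp: R'_def)
  have asc: "ascent_sum R L = ascent_sum R' L + card {r \<in> R'. ?i < r \<and> (\<exists>a<?i. farthest R' L r a)}"
    unfolding R by (rule ascent_sum_insert_max[OF fin _ z]) (use D(3) in \<open>auto simp: R\<close>)
  show ?case
  proof (cases "m = 0")
    case True
    then have "R' = {}" using card fin by simp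
    then show ?thesis using M asc True
      by (intro exI[of _ L]) (simp add: R crossings_def crossing_def ascent_sum_def)
  next
    case False
    obtain L1 where L1: "phi_rec m (arc_set R' L) = arc_set R' L1" "matching R' L1" "L1 ` R' = L ` R'"
      "crossings R' L1 = ascent_sum R' L" "\<And>p a. farthest R' L1 p a = farthest R' L p a"
      using Suc.IH[OF M' card] by blast
    have "?i \<notin> L1 ` R'" using iR L1(3) by simp
    from algorithms_outcome[OF L1(2) this iR(1) z] obtain L2 where
      L2: "alg2 ?i z (arc_set R' L1) (alg1 ?i z (arc_set R' L1)) = arc_set R' L2" "rearranges ?i R' L1 L2"
      "crossings R' L2 + card {r \<in> R'. ?i < r \<and> L1 r < ?i} =
       crossings R' L1 + card {r \<in> R'. ?i < r \<and> (\<exists>a<?i. farthest R' L1 r a)}" by blast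
    have M2: "matching R' L2" "L2 ` R' = L ` R'" using L2(2) L1(3) by (auto simp: rearranges_def)
    define L' where "L' = L2(z := ?i)"
    have L': "L' z = ?i" "\<And>r. r \<in> R' \<Longrightarrow> L' r = L2 r" using zn by (auto simp: L'_def)
    have im': "L' ` R' = L ` R'" using L'(2) M2(2) by (metis image_cong)
    have "Field (arc_set R L) = L ` R \<union> R" by (auto simp: Field_def arc_set_def image_iff)
    moreover have "Max (L ` R \<union> R) = z"
      using D(1,3) zR z R by (intro Max_eqI) (auto simp: le_less intro: order.strict_trans)
    ultimately have mx: "Max (Field (arc_set R L)) = z" by simp
    have rest: "arc_set R L - {(?i, z)} = arc_set R' L" using zn by (auto simp: R arc_set_def)
    have "phi_rec (Suc m) (arc_set R L) = arc_set R' L2 \<union> {(?i, z)}"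
      using False zR by (simp add: mx rest L1(1) L2(1) Let_def)
    also have "\<dots> = arc_set R L'" using L' by (auto simp: R arc_set_def image_iff)
    finally have phi: "phi_rec (Suc m) (arc_set R L) = arc_set R L'" .
    have im: "L' ` R = L ` R" using im' L'(1) by (simp add: R)
    have inj: "inj_on L' R"
    proof -
      have "inj_on L' R'" using matchingD(2)[OF M2(1)] L'(2) by (simp cong: inj_on_cong)
      then show ?thesis using im' iR(2) L'(1) zn by (simp add: R)
    qed
    have "\<forall>r\<in>R. L' r < r" using L' D(3) matchingD(3)[OF M2(1)] by (auto simp: R)
    then have mat: "matching R L'" using inj D(1) M im by (simp add: matching_def arc_system_def)
    have cr: "crossings R L' = crossings R' L2 + card {r \<in> R'. ?i < r \<and> L2 r < ?i}"
    proof -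
      have "crossings R L' = crossings R' L' + card {r \<in> R'. ?i < r \<and> L' r < ?i}"
        unfolding R using crossings_insert_max[OF fin z, of L'] L'(1) by simp
      moreover have "crossings R' L' = crossings R' L2" by (rule crossings_cong) (rule L'(2))
      moreover have "{r \<in> R'. ?i < r \<and> L' r < ?i} = {r \<in> R'. ?i < r \<and> L2 r < ?i}"
        using L'(2) by auto
      ultimately show ?thesis by simp
    qed
    have "card {r \<in> R'. ?i < r \<and> L2 r < ?i} = card {r \<in> R'. ?i < r \<and> L1 r < ?i}"
      using L2(2) by (intro card_large_eq[OF L1(2)]) (auto simp: rearranges_def)
    then have "crossings R L' = ascent_sum R L" using cr L2(3) L1(4,5) asc by simp
    moreover have "farthest R L' p a = farthest R L p a" for p a
    proof (cases "?i < p")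
      case True then show ?thesis unfolding R farthest_insert_max[OF z] using L'(1) by simp
    next
      case False
      have "farthest R' L' p a = farthest R' L2 p a" unfolding farthest_def using L'(2) by auto
      also have "\<dots> = farthest R' L p a" using L2(2) L1(5) False by (auto simp: rearranges_def)
      finally show ?thesis unfolding R farthest_insert_max[OF z] using L'(1) False by simp
    qed
    ultimately show ?thesis using phi mat im by blast
  qed
qed

section \<open>Set partitions\<close>

lemma arc_set_of_relation:
  fixes A :: "('a::linorder \<times> 'a) set"
  assumes "finite A" and lt: "\<And>a b. (a, b) \<in> A \<Longrightarrow> a < b"
    and inj: "\<And>a b b'. (a, b) \<in> A \<Longrightarrow> (a, b') \<in> A \<Longrightarrow> b = b'"
    and fn: "\<And>a a' b. (a, b) \<in> A \<Longrightarrow> (a', b) \<in> A \<Longrightarrow> a = a'"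
  obtains R L where "A = arc_set R L" "arc_system R L"
proof (rule that)
  have L: "left_end A b = a" if "(a, b) \<in> A" for a b
    unfolding left_end_def using that fn by blast
  show "A = arc_set (Range A) (left_end A)" using L by (auto simp: set_eq_iff)
  show "arc_system (Range A) (left_end A)"
    unfolding arc_system_def inj_on_def using L lt inj assms(1) by (auto simp: finite_Range)
qed

lemma arcs_partition_on:
  fixes V :: "'a::linorder set"
  assumes P: "partition_on V P" and V: "finite V"
  obtains R L where "arcs P = arc_set R L" "arc_system R L" "arcs P \<subseteq> V \<times> V"
proof -
  have sub: "arcs P \<subseteq> V \<times> V" using P by (auto simp: arcs_def partition_on_def)
  have same: "B = C" if "B \<in> P" "C \<in> P" "x \<in> B" "x \<in> C" for B C x
    using partition_onD2[OF P] that by (auto simp: disjoint_def)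
  have "b = b'" if "(a, b) \<in> arcs P" "(a, b') \<in> arcs P" for a b b'
    using that unfolding arcs_def by clarsimp (metis same linorder_neqE)
  moreover have "a = a'" if "(a, b) \<in> arcs P" "(a', b) \<in> arcs P" for a a' b
    using that unfolding arcs_def by clarsimp (metis same linorder_neqE)
  moreover have "a < b" if "(a, b) \<in> arcs P" for a b using that by (auto simp: arcs_def)
  moreover have "finite (arcs P)" by (rule finite_subset[OF sub]) (simp add: V)
  ultimately show ?thesis using that sub by (metis arc_set_of_relation)
qed

text \<open>As every vertex has at most one arc on each side, a connected component is a single increasing
path, and its consecutive elements are the arcs of the path.\<close>

lemma arcs_partition_of_arcs:
  assumes A: "arc_system R L" and sub: "arc_set R L \<subseteq> V \<times> V"
  shows "arcs (partition_of_arcs V (arc_set R L)) = arc_set R L"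
proof -
  let ?A = "arc_set R L"
  let ?E = "(?A \<union> ?A\<inverse>)\<^sup>*"
  have inj: "b = b'" if "(a, b) \<in> ?A" "(a, b') \<in> ?A" for a b b'
    using that A by (auto simp: arc_system_def inj_on_def)
  have fn: "a = a'" if "(a, b) \<in> ?A" "(a', b) \<in> ?A" for a a' b
    using that by auto
  have mono: "x \<le> y" if "(x, y) \<in> ?A\<^sup>*" for x y
    using that by (induction rule: rtrancl_induct) (use A in \<open>auto simp: arc_system_def intro: less_imp_le order.trans\<close>)
  \<comment> \<open>No vertex has two arcs on the same side, so a walk may cancel its turns and becomes monotone.\<close>
  have chain: "(x, y) \<in> ?A\<^sup>* \<or> (y, x) \<in> ?A\<^sup>*" if "(x, y) \<in> ?E" for x y
    using that
  proof (induction rule: rtrancl_induct)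
    case base then show ?case by blast
  next
    case (step y z)
    from step.IH step.hyps(2) consider "(x, y) \<in> ?A\<^sup>*" "(y, z) \<in> ?A" | "(x, y) \<in> ?A\<^sup>*" "(z, y) \<in> ?A"
      | "(y, x) \<in> ?A\<^sup>*" "(y, z) \<in> ?A" | "(y, x) \<in> ?A\<^sup>*" "(z, y) \<in> ?A" by blast
    then show ?case
    proof cases
      case 1 then show ?thesis by (blast intro: rtrancl_into_rtrancl)
    next
      case 2
      from 2(1) show ?thesis
      proof (cases rule: rtranclE)
        case base then show ?thesis using 2(2) by blast
      next
        case (step w) then show ?thesis using fn[OF step(2) 2(2)] by blast
      qed
    next
      case 3
      from 3(1) show ?thesis
      proof (cases rule: converse_rtranclE)
        case base then show ?thesis using 3(2) by blast
      next
        case (step w) then show ?thesis using inj[OF step(1) 3(2)] by blast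
      qed
    next
      case 4 then show ?thesis by (blast intro: converse_rtrancl_into_rtrancl)
    qed
  qed
  have up: "(x, y) \<in> ?A\<^sup>*" if "(x, y) \<in> ?E" "x < y" for x y
    using chain[OF that(1)] mono[of y x] that(2) by auto
  have E_sym: "(y, x) \<in> ?E" if "(x, y) \<in> ?E" for x y
    using that by (rule symD[OF sym_rtrancl, rotated]) (auto simp: sym_def)
  show ?thesis
  proof (intro equalityI subrelI)
    fix a b assume "(a, b) \<in> arcs (partition_of_arcs V ?A)"
    then obtain x where x: "(x, a) \<in> ?E" "(x, b) \<in> ?E" and ab: "a < b"
      and no: "\<And>k. (x, k) \<in> ?E \<Longrightarrow> \<not> (a < k \<and> k < b)"
      by (auto simp: arcs_def partition_of_arcs_def quotient_def)
    have "(a, b) \<in> ?E" using E_sym[OF x(1)] x(2) by (rule rtrancl_trans)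
    from up[OF this ab] show "(a, b) \<in> ?A"
    proof (cases rule: converse_rtranclE)
      case base then show ?thesis using ab by simp
    next
      case (step k)
      have "(x, k) \<in> ?E" using x(1) step(1) by (auto intro: rtrancl_into_rtrancl)
      moreover have "a < k" using step(1) A by (auto simp: arc_system_def)
      ultimately have "k = b" using no[of k] mono[OF step(2)] by auto
      then show ?thesis using step(1) by simp
    qed
  next
    fix a b assume ab: "(a, b) \<in> ?A"
    have "a \<in> V" using subsetD[OF sub ab] by simp
    then have "?E `` {a} \<in> partition_of_arcs V ?A" by (auto simp: partition_of_arcs_def quotient_def)
    moreover have "(a, b) \<in> ?E" using ab by auto
    moreover have lt: "a < b" using ab A by (auto simp: arc_system_def)
    moreover have "\<not> (a < k \<and> k < b)" if "(a, k) \<in> ?E" for k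
    proof
      assume k: "a < k \<and> k < b"
      then have "(a, k) \<in> ?A\<^sup>*" using up that by blast
      then show False
      proof (cases rule: converse_rtranclE)
        case base then show ?thesis using k by simp
      next
        case (step w)
        then show ?thesis using inj[OF step(1) ab] mono[OF step(2)] k by auto
      qed
    qed
    ultimately show "(a, b) \<in> arcs (partition_of_arcs V ?A)"
      unfolding arcs_def by (auto intro!: bexI[of _ "?E `` {a}"])
  qed
qed

lemma cr2_eq_crossings:
  assumes P: "arcs P = arc_set R L" and fin: "finite R"
  shows "cr2 P = crossings R L"
proof -
  let ?X = "SIGMA r:R. {s \<in> R. crossing L r s}"
  let ?f = "\<lambda>(r, s). {(L r, r), (L s, s)}"
  have "{{e, f} | e f. e \<in> arcs P \<and> f \<in> arcs P \<and> crosses e f} = ?f ` ?X" (is "?C = _")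
  proof (intro equalityI subsetI)
    fix c assume "c \<in> ?C"
    then obtain r s where c: "c = {(L r, r), (L s, s)}" "r \<in> R" "s \<in> R" "crosses (L r, r) (L s, s)"
      unfolding P arc_set_def by blast
    then consider "crossing L r s" | "crossing L s r" by (auto simp: crosses_def crossing_def)
    then show "c \<in> ?f ` ?X"
    proof cases
      case 1 then show ?thesis using c by (intro image_eqI[of _ _ "(r, s)"]) auto
    next
      case 2 then show ?thesis using c by (intro image_eqI[of _ _ "(s, r)"]) auto
    qed
  next
    fix c assume "c \<in> ?f ` ?X"
    then obtain r s where "c = {(L r, r), (L s, s)}" "r \<in> R" "s \<in> R" "crossing L r s" by auto
    then show "c \<in> ?C" unfolding P arc_set_def
      by (intro CollectI exI[of _ "(L r, r)"] exI[of _ "(L s, s)"])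
        (auto simp: crosses_def crossing_def)
  qed
  moreover have "inj_on ?f ?X"
    by (rule inj_onI) (auto simp: doubleton_eq_iff crossing_def)
  moreover have "crossings R L = card ?X"
    unfolding crossings_def using fin by (simp add: Int_def)
  ultimately show ?thesis by (simp add: cr2_def card_image)
qed

text \<open>Splitting moves a right-hand endpoint \<open>r\<close> to the even number \<open>2 * r\<close> and a left-hand endpoint
\<open>l\<close> to the odd number \<open>2 * l + 1\<close>.\<close>

definition split_left :: "(nat \<Rightarrow> nat) \<Rightarrow> nat \<Rightarrow> nat" where
  "split_left L v = 2 * L (v div 2) + 1"

lemma matching_split:
  assumes "arc_system R L"
  shows "matching ((*) 2 ` R) (split_left L)"
proof -
  have "split_left L (2 * r) < 2 * r" if "r \<in> R" for r
  proof -
    have "L r < r" using assms that by (simp add: arc_system_def)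
    then show ?thesis by (simp add: split_left_def)
  qed
  moreover have "inj_on (split_left L) ((*) 2 ` R)"
    using assms by (auto simp: arc_system_def inj_on_def split_left_def)
  moreover have "split_left L v \<noteq> 2 * r" for v r
    unfolding split_left_def by presburger
  ultimately show ?thesis using assms
    by (auto simp: matching_def arc_system_def)
qed

lemma split_matching_arc_set:
  assumes "arcs P = arc_set R L"
  shows "split_matching P = arc_set ((*) 2 ` R) (split_left L)"
  unfolding split_matching_def assms by (simp add: arc_set_def image_image split_left_def)

lemma ascent_sum_split:
  assumes "arc_system R L"
  shows "ascent_sum ((*) 2 ` R) (split_left L) = ascent_sum R L"
proof -
  have fin: "finite R" using assms by (simp add: arc_system_def)
  have over: "arcs_over ((*) 2 ` R) (split_left L) (2 * r) = map ((*) 2) (arcs_over R L r)" for r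
  proof -
    have iff: "split_left L (2 * s) < 2 * r \<longleftrightarrow> L s < r" for s unfolding split_left_def by simp presburger
    have "{s \<in> (*) 2 ` R. 2 * r \<le> s \<and> split_left L s < 2 * r} = (*) 2 ` {s \<in> R. r \<le> s \<and> L s < r}"
      using iff by auto
    then show ?thesis unfolding arcs_over_def
      using fin by (intro sorted_list_of_set_eqI) (auto simp: sorted_wrt_map)
  qed
  have "ascents (map (split_left L) (map ((*) 2) xs)) = ascents (map L xs)" for xs
    unfolding map_map by (rule ascents_map_mono) (simp add: split_left_def)
  then have "ascents (map (split_left L) (arcs_over ((*) 2 ` R) (split_left L) (2 * r))) =
      ascents (map L (arcs_over R L r))" for r unfolding over .
  then show ?thesis unfolding ascent_sum_def by (subst sum.reindex) (auto simp: inj_on_def)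
qed

text \<open>An arc ending at a vertex and an arc starting there do not cross, whether or not the vertex is split,
because \<^term>\<open>crossing\<close> compares endpoints strictly. This is why halving the numbers keeps all
crossings. Left-hand endpoints are odd because phi does not change their set.\<close>

lemma merge_split:
  fixes R :: "nat set" and F :: "nat \<Rightarrow> nat"
  assumes F: "matching ((*) 2 ` R) F" and odd: "\<And>r. r \<in> R \<Longrightarrow> odd (F (2 * r))"
  defines "L \<equiv> \<lambda>r. F (2 * r) div 2"
  shows "map_prod (\<lambda>v. v div 2) (\<lambda>v. v div 2) ` arc_set ((*) 2 ` R) F = arc_set R L"
    and "arc_system R L" and "crossings R L = crossings ((*) 2 ` R) F"
proof -
  have FL: "F (2 * r) = 2 * L r + 1" if "r \<in> R" for r
    using odd[OF that] by (simp add: L_def)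
  show "map_prod (\<lambda>v. v div 2) (\<lambda>v. v div 2) ` arc_set ((*) 2 ` R) F = arc_set R L"
    unfolding arc_set_def L_def by (simp add: image_image)
  note D = matchingD[OF F]
  have "finite R" using D(1) by (rule finite_imageD) (simp add: inj_on_def)
  moreover have "inj_on L R"
  proof (rule inj_onI)
    fix r s assume rs: "r \<in> R" "s \<in> R" "L r = L s"
    then have "F (2 * r) = F (2 * s)" using FL by simp
    then show "r = s" using D(5)[of "2 * r" "2 * s"] rs by simp
  qed
  moreover have "L r < r" if "r \<in> R" for r using D(3)[of "2 * r"] FL[OF that] that by simp
  ultimately show "arc_system R L" by (simp add: arc_system_def)
  have "crossing F (2 * r) (2 * s) = crossing L r s" if "r \<in> R" "s \<in> R" for r s
    using FL[OF that(1)] FL[OF that(2)] by (auto simp: crossing_def)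
  then show "crossings R L = crossings ((*) 2 ` R) F"
    unfolding crossings_def by (simp add: sum.reindex inj_on_def cong: sum.cong)
qed

theorem theorem8:
  fixes n :: nat and S T :: "nat set" and M :: "nat set set"
  assumes "n \<ge> 1"
    and "S \<subseteq> {1..n}" and "T \<subseteq> {1..n}" and "card S = card T"
    and "M \<in> set_partitions n S T"
  shows "pmaj M = cr2 (phi M)"
proof -
  have P: "partition_on {1..n} M" using assms(5) by (simp add: set_partitions_def)
  obtain R L where RL: "arcs M = arc_set R L" "arc_system R L" "arcs M \<subseteq> {1..n} \<times> {1..n}"
    using arcs_partition_on[OF P] by auto
  let ?R = "(*) 2 ` R"
  have mat: "matching ?R (split_left L)" by (rule matching_split[OF RL(2)])
  from phi_rec_arc_set[OF mat refl] obtain F where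
    F: "phi_rec (card ?R) (arc_set ?R (split_left L)) = arc_set ?R F"
    "matching ?R F" "F ` ?R = split_left L ` ?R" "crossings ?R F = ascent_sum ?R (split_left L)"
    by blast
  have phi: "phi_matching (split_matching M) = arc_set ?R F"
    using F(1) by (simp add: phi_matching_def split_matching_arc_set[OF RL(1)])
  define L' where "L' = (\<lambda>r. F (2 * r) div 2)"
  have from_L: "\<exists>s\<in>R. F (2 * r) = 2 * L s + 1" if "r \<in> R" for r
  proof -
    have "F (2 * r) \<in> split_left L ` ?R" using F(3) that by blast
    then show ?thesis by (auto simp: split_left_def)
  qed
  have "odd (F (2 * r))" if "r \<in> R" for r using from_L[OF that] by auto
  note merge = merge_split[OF F(2) this, folded L'_def]
  have halves: "map_prod (\<lambda>v. v div 2) (\<lambda>v. v div 2) ` arc_set ?R F = arc_set R L'"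
    by (rule merge(1))
  have sub: "arc_set R L' \<subseteq> {1..n} \<times> {1..n}"
  proof (rule subrelI)
    fix a r assume "(a, r) \<in> arc_set R L'"
    then have r: "r \<in> R" "a = L' r" by auto
    then obtain s where s: "s \<in> R" "a = L s" using from_L[OF r(1)] by (auto simp: L'_def)
    have "(L r, r) \<in> arcs M" "(L s, s) \<in> arcs M" using r s by (auto simp: RL(1))
    then show "(a, r) \<in> {1..n} \<times> {1..n}" using RL(3) s(2) by auto
  qed
  have "\<Union> M = {1..n}" using P by (simp add: partition_on_def)
  then have "arcs (phi M) = arc_set R L'"
    unfolding phi_def phi halves using arcs_partition_of_arcs[OF merge(2) sub] by simp
  then have "cr2 (phi M) = crossings R L'"
    using cr2_eq_crossings merge(2) by (auto simp: arc_system_def)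
  also have "\<dots> = crossings ?R F" by (rule merge(3))
  also have "\<dots> = ascent_sum R L"
    unfolding F(4) by (rule ascent_sum_split[OF RL(2)])
  also have "\<dots> = pmaj M" by (rule pmaj_eq_ascent_sum[OF RL(1,2), symmetric])
  finally show ?thesis by simp
qed

end
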